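(* Let $q\in[0,1)$. The only Hilbert space of functions which is analytic in a neighborhood of the origin and for which $$R_q^*=M_z$$ is $\mathbf H_{2,q}$ (up to a multiplicative factor for the inner product).
   Context: For $q\in[0,1)$ put $[n]_q=1+q+\cdots+q^{n-1}$ for $n\ge 1$, $[0]_q!=1$ and $[n]_q!=[1]_q[2]_q\cdots[n]_q$. The space $\mathbf H_{2,q}$ is the reproducing kernel Hilbert space of functions analytic in $|z|<\frac1{1-q}$ with reproducing kernel $E_q(z\overline w)=\sum_{n=0}^\infty\frac{z^n\overline w^n}{[n]_q!}$; a power series $f(z)=\sum_{n\ge0}a_nz^n$ belongs to $\mathbf H_{2,q}$ if and only if $\sum_{n\ge0}[n]_q!\,|a_n|^2<\infty$, and $\langle z^n,z^m\rangle_{\mathbf H_{2,q}}=[n]_q!\,\delta_{n,m}$. The operator $M_z$ is multiplication by $z$, and $R_qf(z)=\frac{f(z)-f(qz)}{(1-q)z}$. The adjoint $R_q^*$ is taken in the Hilbert space under consideration.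
   Formalization: H_{2,q} is taken on |z|<1/sqrt(1-q), as its functions need not be analytic in |z|<1/(1-q); uniqueness is near 0, for nonzero spaces on a connected neighborhood of 0, with bounded point evaluations or with R_q and M_z defined on the whole space. *)

theory Defs
  imports "HOL-Complex_Analysis.Complex_Analysis"
begin

text \<open>
  Functions on an open set \<open>\<Omega>\<close> are represented by total functions that vanish outside \<open>\<Omega>\<close>, so that
  HOL equality is equality of functions on \<open>\<Omega>\<close>. Inner products are linear in the first argument.
\<close>

definition ip_norm :: "((complex \<Rightarrow> complex) \<Rightarrow> (complex \<Rightarrow> complex) \<Rightarrow> complex) \<Rightarrow> (complex \<Rightarrow> complex) \<Rightarrow> real"
  where "ip_norm ip f = sqrt (Re (ip f f))"

locale analytic_hilbert_space =
  fixes \<Omega> :: "complex set"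
    and H :: "(complex \<Rightarrow> complex) set"
    and ip :: "(complex \<Rightarrow> complex) \<Rightarrow> (complex \<Rightarrow> complex) \<Rightarrow> complex"
  assumes domain: "open \<Omega>" "connected \<Omega>" "0 \<in> \<Omega>"
    and analytic: "\<And>f. f \<in> H \<Longrightarrow> f holomorphic_on \<Omega>"
    and outside: "\<And>f z. f \<in> H \<Longrightarrow> z \<notin> \<Omega> \<Longrightarrow> f z = 0"
    and zero_mem: "(\<lambda>z. 0) \<in> H"
    and add_mem: "\<And>f g. f \<in> H \<Longrightarrow> g \<in> H \<Longrightarrow> (\<lambda>z. f z + g z) \<in> H"
    and scale_mem: "\<And>c f. f \<in> H \<Longrightarrow> (\<lambda>z. c * f z) \<in> H"
    and ip_add: "\<And>f g h. f \<in> H \<Longrightarrow> g \<in> H \<Longrightarrow> h \<in> H \<Longrightarrow> ip (\<lambda>z. f z + g z) h = ip f h + ip g h"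
    and ip_scale: "\<And>c f h. f \<in> H \<Longrightarrow> h \<in> H \<Longrightarrow> ip (\<lambda>z. c * f z) h = c * ip f h"
    and ip_cnj: "\<And>f g. f \<in> H \<Longrightarrow> g \<in> H \<Longrightarrow> ip g f = cnj (ip f g)"
    and ip_nonneg: "\<And>f. f \<in> H \<Longrightarrow> 0 \<le> Re (ip f f)"
    and ip_definite: "\<And>f. f \<in> H \<Longrightarrow> ip f f = 0 \<Longrightarrow> f = (\<lambda>z. 0)"
    and complete: "\<And>X :: nat \<Rightarrow> complex \<Rightarrow> complex.
          (\<And>n. X n \<in> H) \<Longrightarrow>
          (\<And>e. e > 0 \<Longrightarrow> \<exists>N. \<forall>m\<ge>N. \<forall>n\<ge>N. ip_norm ip (\<lambda>z. X m z - X n z) < e) \<Longrightarrow>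
          \<exists>f\<in>H. (\<lambda>n. ip_norm ip (\<lambda>z. X n z - f z)) \<longlonglongrightarrow> 0"

definition bounded_evaluations where
  "bounded_evaluations \<Omega> H ip \<longleftrightarrow>
     (\<forall>w\<in>\<Omega>. \<exists>C. \<forall>f\<in>H. cmod (f w) \<le> C * ip_norm ip f)"

definition has_reproducing_kernel where
  "has_reproducing_kernel \<Omega> H ip K \<longleftrightarrow>
     (\<forall>w\<in>\<Omega>. (\<lambda>z. if z \<in> \<Omega> then K z w else 0) \<in> H \<and>
           (\<forall>f\<in>H. (f w :: complex) = ip f (\<lambda>z. if z \<in> \<Omega> then K z w else 0)))"

text \<open>
  Operators in \<open>H\<close> are given by their graphs, on the maximal domain. As \<open>\<Omega>\<close> need not be invariant
  under \<open>z \<mapsto> q z\<close>, the formula for \<open>R\<^sub>q f\<close> is imposed on a punctured neighborhood of the origin,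
  which determines \<open>R\<^sub>q f\<close> on the connected set \<open>\<Omega>\<close>.
\<close>

definition Rq_graph :: "real \<Rightarrow> (complex \<Rightarrow> complex) set \<Rightarrow> ((complex \<Rightarrow> complex) \<times> (complex \<Rightarrow> complex)) set"
  where "Rq_graph q H = {(f, g). f \<in> H \<and> g \<in> H \<and>
     (\<forall>\<^sub>F z in at 0. g z = (f z - f (of_real q * z)) / ((1 - of_real q) * z))}"

definition Mz_graph :: "(complex \<Rightarrow> complex) set \<Rightarrow> ((complex \<Rightarrow> complex) \<times> (complex \<Rightarrow> complex)) set"
  where "Mz_graph H = {(f, g). f \<in> H \<and> g \<in> H \<and> g = (\<lambda>z. z * f z)}"

text \<open>
  The adjoint as a linear relation; it is the graph of an operator exactly when the domain of \<open>T\<close>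
  is dense. So an equation \<open>adjoint_graph H ip T = Mz_graph H\<close> includes the density of the domain
  of \<open>T\<close> as well as the equality of the domains of \<open>T\<^sup>*\<close> and \<open>M\<^sub>z\<close>.
\<close>

definition adjoint_graph where
  "adjoint_graph H ip T =
     {(g, h). g \<in> H \<and> h \<in> H \<and> (\<forall>(f, f')\<in>T. (ip f' g :: complex) = ip f h)}"

definition q_int :: "real \<Rightarrow> nat \<Rightarrow> real"
  where "q_int q n = (\<Sum>k<n. q ^ k)"

definition q_fact :: "real \<Rightarrow> nat \<Rightarrow> real"
  where "q_fact q n = (\<Prod>k=1..n. q_int q k)"

definition E_q :: "real \<Rightarrow> complex \<Rightarrow> complex"
  where "E_q q z = (\<Sum>n. z ^ n / of_real (q_fact q n))"

definition taylor_coeff :: "(complex \<Rightarrow> complex) \<Rightarrow> nat \<Rightarrow> complex"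
  where "taylor_coeff f n = (deriv ^^ n) f 0 / fact n"

text \<open>
  The kernel \<open>E_q q (z * cnj w)\<close> converges for \<open>\<bar>z * cnj w\<bar> < 1 / (1 - q)\<close>; hence the functions of the
  space, i.e. the power series whose coefficients satisfy the summability condition below, live on
  the disc of radius \<open>1 / sqrt (1 - q)\<close>.
\<close>

definition H2q_disc :: "real \<Rightarrow> complex set"
  where "H2q_disc q = ball 0 (1 / sqrt (1 - q))"

definition H2q :: "real \<Rightarrow> (complex \<Rightarrow> complex) set"
  where "H2q q = {f. f holomorphic_on H2q_disc q \<and> (\<forall>z. z \<notin> H2q_disc q \<longrightarrow> f z = 0) \<and>
                     summable (\<lambda>n. q_fact q n * (cmod (taylor_coeff f n))\<^sup>2)}"

definition H2q_inner :: "real \<Rightarrow> (complex \<Rightarrow> complex) \<Rightarrow> (complex \<Rightarrow> complex) \<Rightarrow> complex"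
  where "H2q_inner q f g =
     (\<Sum>n. of_real (q_fact q n) * taylor_coeff f n * cnj (taylor_coeff g n))"

text \<open>
  Functions analytic on different neighborhoods of the origin are identified when they agree near
  the origin. The form \<open>H2q_inner\<close> depends only on the Taylor coefficients at the origin, so it can
  be applied to the elements of \<open>H\<close> directly.
\<close>

definition equals_H2q_up_to_factor where
  "equals_H2q_up_to_factor q H ip \<longleftrightarrow>
     (\<forall>f\<in>H. \<exists>g\<in>H2q q. \<forall>\<^sub>F z in nhds 0. f z = g z) \<and>
     (\<forall>g\<in>H2q q. \<exists>f\<in>H. \<forall>\<^sub>F z in nhds 0. f z = g z) \<and>
     (\<exists>c::real. c > 0 \<and> (\<forall>f\<in>H. \<forall>g\<in>H. ip f g = of_real c * H2q_inner q f g))"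

end

theory Submission
  imports Defs
begin

text \<open>
  On Taylor coefficients, \<open>g = R\<^sub>q f\<close> reads \<open>b\<^sub>n = [n + 1] a\<^sub>n\<^sub>+\<^sub>1\<close>. For uniqueness it suffices to show that
  the monomials belong to \<open>H\<close> and that \<open>\<langle>f, z\<^sup>n\<rangle> = c [n]! a\<^sub>n(f)\<close>; Bessel's inequality and completeness then
  identify \<open>H\<close> with the weighted sequence space.

  If \<open>R\<^sub>q\<close> and \<open>M\<^sub>z\<close> are defined everywhere, the commutation relation \<open>R\<^sub>q M\<^sub>z = I + q M\<^sub>z R\<^sub>q\<close> and
  \<open>R\<^sub>q\<^sup>* = M\<^sub>z\<close> give \<open>\<parallel>M\<^sub>z f\<parallel> \<ge> \<parallel>f\<parallel>\<close>, so \<open>M\<^sub>z\<close> has closed range, whose orthogonal complement is the kernel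
  of \<open>R\<^sub>q\<close>, i.e. the constants in \<open>H\<close>. The constants are in \<open>H\<close>, since otherwise every element of \<open>H\<close> would
  be divisible by all powers of \<open>z\<close>. Applying the adjoint relation \<open>n\<close> times yields \<open>\<langle>f, z\<^sup>n\<rangle>\<close>.

  If point evaluations are bounded, \<open>R\<^sub>q\<close> is closed and thus equals \<open>M\<^sub>z\<^sup>*\<close>, so the kernel function \<open>k\<^sub>w\<close> is
  an eigenvector of \<open>R\<^sub>q\<close> with eigenvalue \<open>cnj w\<close>. This forces \<open>k\<^sub>w(z) = c E\<^sub>q(z cnj w)\<close>, and the
  representer of the \<open>n\<close>-th Taylor coefficient is then \<open>c z\<^sup>n / [n]!\<close>.
\<close>

section \<open>Hilbert spaces of functions\<close>

text \<open>Used for three spaces: \<open>H\<close> itself, the range of \<open>M\<^sub>z\<close> in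
  \<open>H\<close>, and the graph of \<open>R\<^sub>q\<close> in \<open>H \<oplus> H\<close>. Hence
  the arbitrary index type \<open>'i\<close> and the absence of analyticity.\<close>

locale hilbert_function_space =
  fixes H :: "('i \<Rightarrow> complex) set"
    and ip :: "('i \<Rightarrow> complex) \<Rightarrow> ('i \<Rightarrow> complex) \<Rightarrow> complex"
  assumes zero_mem: "(\<lambda>z. 0) \<in> H"
    and add_mem: "\<And>f g. f \<in> H \<Longrightarrow> g \<in> H \<Longrightarrow> (\<lambda>z. f z + g z) \<in> H"
    and scale_mem: "\<And>c f. f \<in> H \<Longrightarrow> (\<lambda>z. c * f z) \<in> H"
    and ip_add: "\<And>f g h. f \<in> H \<Longrightarrow> g \<in> H \<Longrightarrow> h \<in> H \<Longrightarrow> ip (\<lambda>z. f z + g z) h = ip f h + ip g h"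
    and ip_scale: "\<And>c f h. f \<in> H \<Longrightarrow> h \<in> H \<Longrightarrow> ip (\<lambda>z. c * f z) h = c * ip f h"
    and ip_cnj: "\<And>f g. f \<in> H \<Longrightarrow> g \<in> H \<Longrightarrow> ip g f = cnj (ip f g)"
    and ip_nonneg: "\<And>f. f \<in> H \<Longrightarrow> 0 \<le> Re (ip f f)"
    and complete: "\<And>X :: nat \<Rightarrow> 'i \<Rightarrow> complex.
          (\<And>n. X n \<in> H) \<Longrightarrow>
          (\<And>e. e > 0 \<Longrightarrow> \<exists>N. \<forall>m\<ge>N. \<forall>n\<ge>N.
             Re (ip (\<lambda>z. X m z - X n z) (\<lambda>z. X m z - X n z)) < e) \<Longrightarrow>
          \<exists>f\<in>H. (\<lambda>n. Re (ip (\<lambda>z. X n z - f z) (\<lambda>z. X n z - f z))) \<longlonglongrightarrow> 0"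
begin

abbreviation sqn :: "('i \<Rightarrow> complex) \<Rightarrow> real" where "sqn f \<equiv> Re (ip f f)"

lemma diff_mem: "f \<in> H \<Longrightarrow> g \<in> H \<Longrightarrow> (\<lambda>z. f z - g z) \<in> H"
  using add_mem[of f "\<lambda>z. (-1) * g z"] scale_mem[of g "-1"] by simp

lemma ip_add_right:
  "f \<in> H \<Longrightarrow> g \<in> H \<Longrightarrow> h \<in> H \<Longrightarrow> ip h (\<lambda>z. f z + g z) = ip h f + ip h g"
  using ip_cnj[of "\<lambda>z. f z + g z" h] ip_cnj[of f h] ip_cnj[of g h] ip_add add_mem
  by simp

lemma ip_scale_right:
  "f \<in> H \<Longrightarrow> h \<in> H \<Longrightarrow> ip h (\<lambda>z. c * f z) = cnj c * ip h f"
  using ip_cnj[of "\<lambda>z. c * f z" h] ip_cnj[of f h] ip_scale scale_mem by simp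

lemma ip_diff:
  assumes "f \<in> H" "g \<in> H" "h \<in> H"
  shows "ip (\<lambda>z. f z - g z) h = ip f h - ip g h"
  using ip_add[of f "\<lambda>z. (-1) * g z" h] ip_scale[of g h "-1"] scale_mem[of g "-1"] assms by simp

lemma ip_diff_right:
  assumes "f \<in> H" "g \<in> H" "h \<in> H"
  shows "ip h (\<lambda>z. f z - g z) = ip h f - ip h g"
  using ip_add_right[of f "\<lambda>z. (-1) * g z" h] ip_scale_right[of g h "-1"] scale_mem[of g "-1"]
    assms by simp

lemma ip_zero_left: "h \<in> H \<Longrightarrow> ip (\<lambda>z. 0) h = 0"
  using ip_scale[of "\<lambda>z. 0" h 0] zero_mem by simp

lemma ip_zero_right: "h \<in> H \<Longrightarrow> ip h (\<lambda>z. 0) = 0"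
  using ip_scale_right[of "\<lambda>z. 0" h 0] zero_mem by simp

lemma sum_mem:
  assumes "\<And>i. i \<in> A \<Longrightarrow> F i \<in> H"
  shows "(\<lambda>z. \<Sum>i\<in>A. F i z) \<in> H"
  using assms
  by (induction A rule: infinite_finite_induct) (auto intro: zero_mem add_mem)

lemma ip_sum:
  assumes "\<And>i. i \<in> A \<Longrightarrow> F i \<in> H" "h \<in> H"
  shows "ip (\<lambda>z. \<Sum>i\<in>A. F i z) h = (\<Sum>i\<in>A. ip (F i) h)"
  using assms
  by (induction A rule: infinite_finite_induct) (auto simp: ip_zero_left ip_add sum_mem)

lemma ip_self_of_real: "f \<in> H \<Longrightarrow> ip f f = of_real (sqn f)"
  using ip_cnj[of f f] by (simp add: complex_eq_iff)

text \<open>The expansion behind Cauchy-Schwarz, the parallelogram law, the variation in the Riesz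
  theorem and Bessel's inequality.\<close>

lemma sqn_add_scale:
  assumes "f \<in> H" "g \<in> H"
  shows "sqn (\<lambda>z. f z + c * g z) = sqn f + 2 * Re (cnj c * ip f g) + (cmod c)\<^sup>2 * sqn g"
proof -
  have "ip (\<lambda>z. f z + c * g z) (\<lambda>z. f z + c * g z)
      = ip f f + cnj c * ip f g + c * ip g f + c * cnj c * ip g g"
    using assms by (simp add: ip_add ip_add_right ip_scale ip_scale_right scale_mem add_mem algebra_simps)
  moreover have "ip g f = cnj (ip f g)" using assms ip_cnj by blast
  moreover have "c * cnj c * ip g g = of_real ((cmod c)\<^sup>2 * sqn g)"
    by (subst ip_self_of_real[OF assms(2)]) (simp flip: complex_norm_square)
  ultimately show ?thesis by simp
qed

lemma cauchy_schwarz: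
  assumes "f \<in> H" "g \<in> H"
  shows "(cmod (ip f g))\<^sup>2 \<le> sqn f * sqn g"
proof -
  let ?c = "ip f g"
  \<comment> \<open>A scalar proportional to \<open>ip f g\<close> makes the cross term real; what
    remains is a quadratic inequality in the real parameter \<open>t\<close>.\<close>
  have *: "0 \<le> sqn f - 2 * t * (cmod ?c)\<^sup>2 + t\<^sup>2 * (cmod ?c)\<^sup>2 * sqn g" for t :: real
  proof -
    have "0 \<le> sqn (\<lambda>z. f z + (- of_real t * ?c) * g z)"
      by (intro ip_nonneg add_mem scale_mem assms)
    also have "\<dots> = sqn f - 2 * t * (cmod ?c)\<^sup>2 + t\<^sup>2 * (cmod ?c)\<^sup>2 * sqn g"
      unfolding sqn_add_scale[OF assms]
      by (simp add: norm_mult power_mult_distrib flip: complex_norm_square)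
        (simp add: cmod_power2 algebra_simps flip: power2_eq_square)
    finally show ?thesis .
  qed
  show ?thesis
  proof (cases "sqn g = 0")
    case True
    have "cmod ?c = 0"
    proof (rule ccontr)
      assume "cmod ?c \<noteq> 0"
      \<comment> \<open>For \<open>sqn g = 0\<close> the inequality is affine in \<open>t\<close>,
        and this value of \<open>t\<close> turns its right-hand side into
        \<open>- sqn f - 2\<close>.\<close>
      then show False using *[of "(sqn f + 1) / (cmod ?c)\<^sup>2"] True ip_nonneg[OF assms(1)] by simp
    qed
    then show ?thesis using True by simp
  next
    case False
    then have "sqn g > 0" using ip_nonneg[OF assms(2)] by simp
    have "0 \<le> sqn f - (cmod ?c)\<^sup>2 / sqn g"
      using *[of "1 / sqn g"] False by (simp add: power2_eq_square)
    with \<open>sqn g > 0\<close> show ?thesis by (simp add: divide_le_eq)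
  qed
qed

lemma ip_tendsto:
  assumes "\<And>n. X n \<in> H" "f \<in> H" "h \<in> H"
    and lim: "(\<lambda>n. sqn (\<lambda>z. X n z - f z)) \<longlonglongrightarrow> 0"
  shows "(\<lambda>n. ip (X n) h) \<longlonglongrightarrow> ip f h"
proof -
  have "(\<lambda>n. sqrt (sqn (\<lambda>z. X n z - f z) * sqn h)) \<longlonglongrightarrow> sqrt (0 * sqn h)"
    by (intro tendsto_intros lim)
  then have lim': "(\<lambda>n. sqrt (sqn (\<lambda>z. X n z - f z) * sqn h)) \<longlonglongrightarrow> 0" by simp
  have "(\<lambda>n. ip (X n) h - ip f h) \<longlonglongrightarrow> 0"
  proof (rule Lim_null_comparison[OF always_eventually lim'], rule allI)
    fix n
    show "cmod (ip (X n) h - ip f h) \<le> sqrt (sqn (\<lambda>z. X n z - f z) * sqn h)"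
      using cauchy_schwarz[OF diff_mem[OF assms(1)[of n] assms(2)] assms(3)]
        ip_diff[OF assms(1)[of n] assms(2,3)] by (simp add: real_le_rsqrt)
  qed
  then show ?thesis by (simp add: LIM_zero_iff)
qed

lemma ip_tendsto_right:
  assumes "\<And>n. X n \<in> H" "f \<in> H" "h \<in> H"
    and "(\<lambda>n. sqn (\<lambda>z. X n z - f z)) \<longlonglongrightarrow> 0"
  shows "(\<lambda>n. ip h (X n)) \<longlonglongrightarrow> ip h f"
proof -
  have "(\<lambda>n. cnj (ip (X n) h)) \<longlonglongrightarrow> cnj (ip f h)"
    by (rule tendsto_cnj[OF ip_tendsto[OF assms]])
  moreover have "ip h (X n) = cnj (ip (X n) h)" for n by (rule ip_cnj[OF assms(1,3)])
  moreover have "ip h f = cnj (ip f h)" by (rule ip_cnj[OF assms(2,3)])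
  ultimately show ?thesis by simp
qed

text \<open>The representer minimizes \<open>\<parallel>x\<parallel>\<^sup>2 - 2 Re (L x)\<close>.\<close>

theorem riesz_representation:
  assumes L_add: "\<And>f g. f \<in> H \<Longrightarrow> g \<in> H \<Longrightarrow> L (\<lambda>z. f z + g z) = L f + (L g :: complex)"
    and L_scale: "\<And>c f. f \<in> H \<Longrightarrow> L (\<lambda>z. c * f z) = c * L f"
    and L_bdd: "\<And>f. f \<in> H \<Longrightarrow> cmod (L f) \<le> C * sqrt (sqn f)"
  obtains p where "p \<in> H" "\<And>f. f \<in> H \<Longrightarrow> L f = ip f p"
proof -
  define J where "J f = sqn f - 2 * Re (L f)" for f
  define m where "m = Inf (J ` H)"
  have J_lb: "- (C\<^sup>2) \<le> J f" if "f \<in> H" for f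
  proof -
    have "0 \<le> (sqrt (sqn f) - C)\<^sup>2" by simp
    also have "\<dots> = sqn f - 2 * (C * sqrt (sqn f)) + C\<^sup>2"
      using ip_nonneg[OF that] by (simp add: power2_diff)
    finally show ?thesis
      using L_bdd[OF that] complex_Re_le_cmod[of "L f"] by (simp add: J_def)
  qed
  have bdd: "bdd_below (J ` H)" using J_lb by (auto intro!: bdd_belowI)
  have m_le: "m \<le> J f" if "f \<in> H" for f
    unfolding m_def using bdd that by (simp add: cINF_lower)
  have "\<exists>f\<in>H. J f < m + 1 / real (Suc n)" for n
  proof -
    have "Inf (J ` H) < m + 1 / real (Suc n)" by (simp add: m_def)
    moreover have "J ` H \<noteq> {}" using zero_mem by auto
    ultimately obtain y where "y \<in> J ` H" "y < m + 1 / real (Suc n)" using cInf_lessD by metis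
    then show ?thesis by auto
  qed
  then obtain X where X: "\<And>n. X n \<in> H" and XJ: "\<And>n. J (X n) < m + 1 / real (Suc n)"
    by metis
  \<comment> \<open>The parallelogram law, combined with \<open>m \<le> J\<close> at the midpoint of
    \<open>f\<close> and \<open>g\<close>, shows that near-minimizers are close to each other. So
    the minimizing sequence \<open>X\<close> is Cauchy.\<close>
  have par: "sqn (\<lambda>z. f z - g z) \<le> 2 * (J f - m) + 2 * (J g - m)" if "f \<in> H" "g \<in> H" for f g
  proof -
    define h where "h = (\<lambda>z. f z + 1 * g z)"
    have h: "h \<in> H" using add_mem[OF that] by (simp add: h_def)
    have Lh: "L h = L f + L g" using L_add[OF that] by (simp add: h_def)
    have "m \<le> J (\<lambda>z. (1/2) * h z)" by (intro m_le scale_mem h)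
    also have "\<dots> = sqn h / 4 - Re (L f + L g)"
      unfolding J_def L_scale[OF h] ip_scale[OF h scale_mem[OF h]] ip_scale_right[OF h h] Lh
      by (simp add: field_simps)
    finally have "4 * m \<le> sqn h - 4 * Re (L f + L g)" by simp
    moreover have "sqn h = sqn f + 2 * Re (ip f g) + sqn g"
      using sqn_add_scale[OF that, of 1] by (simp add: h_def)
    moreover have "sqn (\<lambda>z. f z - g z) = sqn f - 2 * Re (ip f g) + sqn g"
      using sqn_add_scale[OF that, of "-1"] by simp
    ultimately show ?thesis by (simp add: J_def)
  qed
  have "\<exists>p\<in>H. (\<lambda>n. sqn (\<lambda>z. X n z - p z)) \<longlonglongrightarrow> 0"
  proof (rule complete[OF X])
    fix e :: real assume e: "e > 0"
    then obtain N where N: "1 / real (Suc N) < e / 4"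
      using nat_approx_posE[of "e / 4"] by auto
    have small: "1 / real (Suc n) < e / 4" if "n \<ge> N" for n
    proof -
      have "1 / real (Suc n) \<le> 1 / real (Suc N)" using that by (intro divide_left_mono) auto
      then show ?thesis using N by linarith
    qed
    show "\<exists>N. \<forall>k\<ge>N. \<forall>n\<ge>N. sqn (\<lambda>z. X k z - X n z) < e"
    proof (intro exI[of _ N] allI impI)
      fix k n assume kn: "k \<ge> N" "n \<ge> N"
      have "J (X k) < m + e / 4" "J (X n) < m + e / 4"
        using kn by (meson XJ small add_strict_left_mono less_trans)+
      then show "sqn (\<lambda>z. X k z - X n z) < e"
        using par[OF X[of k] X[of n]] by argo
    qed
  qed
  then obtain p where p: "p \<in> H" and lim: "(\<lambda>n. sqn (\<lambda>z. X n z - p z)) \<longlonglongrightarrow> 0" by blast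
  \<comment> \<open>The first variation of \<open>J\<close> vanishes at the minimizer. The variation
    is expanded at \<open>X n\<close>, where \<open>J\<close> is within \<open>1 / Suc n\<close> of
    \<open>m\<close>, and \<open>n\<close> tends to infinity afterwards.\<close>
  have real_part: "Re (ip x p) = Re (L x)" if x: "x \<in> H" for x
  proof -
    define d where "d = Re (ip x p) - Re (L x)"
    have quad: "0 \<le> 2 * t * d + t\<^sup>2 * sqn x" for t :: real
    proof -
      have "0 \<le> 1 / real (Suc n) + 2 * t * (Re (ip (X n) x) - Re (L x)) + t\<^sup>2 * sqn x" for n
      proof -
        have "m \<le> J (\<lambda>z. X n z + of_real t * x z)" by (intro m_le add_mem scale_mem X x)
        also have "\<dots> = J (X n) + 2 * t * (Re (ip (X n) x) - Re (L x)) + t\<^sup>2 * sqn x"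
          unfolding J_def sqn_add_scale[OF X x]
          using L_add[OF X scale_mem[OF x], of n "of_real t"] L_scale[OF x, of "of_real t"]
          by (simp add: algebra_simps)
        finally show ?thesis using XJ[of n] by linarith
      qed
      moreover have "(\<lambda>n. 1 / real (Suc n) + 2 * t * (Re (ip (X n) x) - Re (L x)) + t\<^sup>2 * sqn x)
          \<longlonglongrightarrow> 0 + 2 * t * (Re (ip p x) - Re (L x)) + t\<^sup>2 * sqn x"
        by (intro tendsto_intros ip_tendsto[OF X p x lim] LIMSEQ_Suc[OF lim_1_over_n])
      ultimately have "0 \<le> 0 + 2 * t * (Re (ip p x) - Re (L x)) + t\<^sup>2 * sqn x"
        by (intro LIMSEQ_le_const) auto
      then show ?thesis using ip_cnj[OF p x] by (simp add: d_def)
    qed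
    have "d = 0"
    proof (rule ccontr)
      assume "d \<noteq> 0"
      \<comment> \<open>This \<open>t\<close> makes the quadratic negative; the added 1 keeps the
        denominator positive even if \<open>sqn x = 0\<close>.\<close>
      have "0 \<le> 2 * (- d / (sqn x + 1)) * d + (- d / (sqn x + 1))\<^sup>2 * sqn x" by (rule quad)
      also have "\<dots> = - (d\<^sup>2) * (sqn x + 2) / (sqn x + 1)\<^sup>2"
      proof -
        have "sqn x + 1 \<noteq> 0" using ip_nonneg[OF x] by linarith
        then have "sqn x + 1 = s \<Longrightarrow> 2 * (- d / s) * d + (- d / s)\<^sup>2 * (s - 1) = - (d\<^sup>2) * (s + 1) / s\<^sup>2" for s
          by (simp add: field_simps power2_eq_square)
        from this[OF refl] show ?thesis by simp
      qed
      also have "\<dots> < 0" using ip_nonneg[OF x] \<open>d \<noteq> 0\<close>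
        by (intro divide_neg_pos mult_neg_pos) auto
      finally show False by simp
    qed
    then show ?thesis by (simp add: d_def)
  qed
  show thesis
  proof (rule that[OF p])
    fix x assume x: "x \<in> H"
    \<comment> \<open>The imaginary parts at \<open>x\<close> are obtained from the real parts at
      \<open>\<i> * x\<close>.\<close>
    have "Re (\<i> * ip x p) = Re (\<i> * L x)"
      using real_part[OF scale_mem[OF x, of "\<i>"]] by (simp only: ip_scale[OF x p] L_scale[OF x])
    then show "L x = ip x p" using real_part[OF x] by (simp add: complex_eq_iff)
  qed
qed

end

section \<open>Taylor coefficients and \<open>q\<close>-integers\<close>

lemma all_nat_iff: "(\<forall>n::nat. P n) \<longleftrightarrow> P 0 \<and> (\<forall>n. P (Suc n))"
  by (metis not0_implies_Suc)

lemma taylor_coeff_eqI: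
  "f has_fps_expansion F \<Longrightarrow> taylor_coeff f n = fps_nth F n"
  by (simp add: taylor_coeff_def fps_nth_fps_expansion)

lemma has_fps_expansion_taylor_coeff:
  "f analytic_on {0} \<Longrightarrow> f has_fps_expansion Abs_fps (taylor_coeff f)"
  using analytic_at_imp_has_fps_expansion_0[of f]
  by (simp add: fps_expansion_def taylor_coeff_def[abs_def])

lemma analytic_on_0I: "f holomorphic_on S \<Longrightarrow> open S \<Longrightarrow> 0 \<in> S \<Longrightarrow> f analytic_on {0}"
  using analytic_at by blast

lemma taylor_coeff_add:
  "f analytic_on {0} \<Longrightarrow> g analytic_on {0} \<Longrightarrow>
   taylor_coeff (\<lambda>z. f z + g z) n = taylor_coeff f n + taylor_coeff g n"
  by (simp add: taylor_coeff_def higher_deriv_add_at add_divide_distrib)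

lemma taylor_coeff_diff:
  "f analytic_on {0} \<Longrightarrow> g analytic_on {0} \<Longrightarrow>
   taylor_coeff (\<lambda>z. f z - g z) n = taylor_coeff f n - taylor_coeff g n"
  by (simp add: taylor_coeff_def higher_deriv_diff_at diff_divide_distrib)

lemma taylor_coeff_cmult:
  "f analytic_on {0} \<Longrightarrow> taylor_coeff (\<lambda>z. c * f z) n = c * taylor_coeff f n"
  by (simp add: taylor_coeff_def higher_deriv_cmult')

lemma taylor_coeff_times_id:
  assumes "f analytic_on {0}"
  shows "taylor_coeff (\<lambda>z. z * f z) n = (if n = 0 then 0 else taylor_coeff f (n - 1))"
  using taylor_coeff_eqI[OF has_fps_expansion_mult[OF has_fps_expansion_fps_X
      has_fps_expansion_taylor_coeff[OF assms]], of n]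
  by (cases n) auto

lemma taylor_coeff_zero_fun [simp]: "taylor_coeff (\<lambda>z. 0) n = 0"
  using taylor_coeff_eqI[OF has_fps_expansion_0, of n] by simp

lemma taylor_coeff_at_0: "taylor_coeff f 0 = f 0"
  by (simp add: taylor_coeff_def)

lemma taylor_coeff_cong:
  "\<forall>\<^sub>F z in nhds 0. f z = g z \<Longrightarrow> taylor_coeff f n = taylor_coeff g n"
  unfolding taylor_coeff_def by (simp add: higher_deriv_cong_ev)

lemma taylor_coeff_monomial:
  assumes "\<forall>\<^sub>F z in nhds 0. f z = z ^ k"
  shows "taylor_coeff f n = (if n = k then 1 else 0)"
  using taylor_coeff_cong[OF assms, of n] taylor_coeff_eqI[OF has_fps_expansion_fps_X_power, of k n]
  by (simp add: fps_X_power_nth)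

lemma taylor_coeff_sums:
  assumes "f holomorphic_on ball 0 r" "cmod z < r"
  shows "(\<lambda>n. taylor_coeff f n * z ^ n) sums f z"
  using holomorphic_power_series[OF assms(1), of z] assms(2) by (simp add: taylor_coeff_def)

lemma taylor_coeff_of_sums:
  assumes "\<And>z. cmod z < r \<Longrightarrow> (\<lambda>n. a n * z ^ n) sums f z" and "r > 0"
  shows "taylor_coeff f n = a n"
proof -
  have "f has_fps_expansion Abs_fps a"
  proof (rule has_fps_expansionI)
    have "\<forall>\<^sub>F u in nhds (0::complex). u \<in> ball 0 r"
      using \<open>r > 0\<close> by (intro eventually_nhds_in_open) auto
    then show "\<forall>\<^sub>F u in nhds 0. (\<lambda>n. fps_nth (Abs_fps a) n * u ^ n) sums f u"
      by eventually_elim (use assms in auto)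
  qed
  then show ?thesis by (simp add: taylor_coeff_eqI)
qed

lemma eventually_eq_iff_taylor_coeff:
  assumes "f analytic_on {0}" "g analytic_on {0}"
  shows "(\<forall>\<^sub>F z in nhds 0. f z = g z) \<longleftrightarrow> (\<forall>n. taylor_coeff f n = taylor_coeff g n)"
proof
  assume "\<forall>n. taylor_coeff f n = taylor_coeff g n"
  then have "Abs_fps (taylor_coeff f) = Abs_fps (taylor_coeff g)" by (simp add: fps_eq_iff)
  with has_fps_expansion_taylor_coeff[OF assms(1)] has_fps_expansion_taylor_coeff[OF assms(2)]
  have "\<forall>\<^sub>F z in nhds 0. eval_fps (Abs_fps (taylor_coeff g)) z = f z"
    "\<forall>\<^sub>F z in nhds 0. eval_fps (Abs_fps (taylor_coeff g)) z = g z"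
    unfolding has_fps_expansion_def by simp_all
  then show "\<forall>\<^sub>F z in nhds 0. f z = g z" by eventually_elim simp
qed (simp add: taylor_coeff_cong)

lemma holomorphic_eqI_taylor_coeff:
  assumes "f holomorphic_on S" "g holomorphic_on S" "open S" "connected S" "0 \<in> S" "z \<in> S"
    and "\<And>n. taylor_coeff f n = taylor_coeff g n"
  shows "f z = g z"
proof (rule holomorphic_fun_eq_on_connected[OF assms(1,2,3,4) _ assms(5,6)])
  fix n show "(deriv ^^ n) f 0 = (deriv ^^ n) g 0"
    using assms(7)[of n] by (simp add: taylor_coeff_def)
qed

lemma taylor_coeff_dilate:
  assumes "f analytic_on {0}"
  shows "taylor_coeff (\<lambda>z. f (q * z)) n = q ^ n * taylor_coeff f n"
    and "(\<lambda>z. f (q * z)) analytic_on {0}"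
proof -
  obtain S where S: "f holomorphic_on S" "open S" "0 \<in> S" using assms analytic_at by blast
  let ?T = "(\<lambda>z. q * z) -` S"
  have T: "open ?T" by (intro open_vimage S continuous_intros)
  have "(deriv ^^ n) (\<lambda>z. f (q * z)) 0 = q ^ n * (deriv ^^ n) f (q * 0)"
    by (rule higher_deriv_compose_linear[OF S(1) T S(2)]) (use S in auto)
  then show "taylor_coeff (\<lambda>z. f (q * z)) n = q ^ n * taylor_coeff f n"
    by (simp add: taylor_coeff_def)
  have "(f \<circ> (\<lambda>z. q * z)) holomorphic_on ?T"
    by (intro holomorphic_on_compose_gen[OF _ S(1)] holomorphic_intros) auto
  then show "(\<lambda>z. f (q * z)) analytic_on {0}"
    using T S(3) by (intro analytic_on_0I[where S = ?T]) (auto simp: o_def)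
qed

section \<open>The \<open>q\<close>-integers and \<open>q\<close>-factorials\<close>

lemma q_int_Suc: "q_int q (Suc n) = q_int q n + q ^ n"
  by (simp add: q_int_def)

text \<open>In \<open>f(z) - f(q z)\<close> the \<open>n\<close>-th coefficient of \<open>f\<close>
  acquires the factor \<open>1 - q ^ n\<close>; dividing by \<open>1 - q\<close> turns this factor
  into the \<open>q\<close>-integer.\<close>

lemma q_int_telescope: "(1 - q) * q_int q n = 1 - q ^ n"
  unfolding q_int_def by (induction n) (simp_all add: distrib_left left_diff_distrib)

lemma q_int_0 [simp]: "q_int q 0 = 0"
  by (simp add: q_int_def)

text \<open>This form of the recursion is the commutation relation
  \<open>R\<^sub>q M\<^sub>z = I + q M\<^sub>z R\<^sub>q\<close> read on coefficients.\<close>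

lemma q_int_Suc_left: "q_int q (Suc n) = 1 + q * q_int q n"
proof (induction n)
  case (Suc n)
  have "q_int q (Suc (Suc n)) = (1 + q * q_int q n) + q * q ^ n"
    using q_int_Suc[of q "Suc n"] Suc.IH by simp
  also have "\<dots> = 1 + q * q_int q (Suc n)" by (simp add: q_int_Suc distrib_left)
  finally show ?case .
qed (simp add: q_int_Suc)

lemma q_int_ge_1: "0 \<le> q \<Longrightarrow> 1 \<le> q_int q (Suc n)"
  by (induction n) (auto simp: q_int_Suc intro: add_increasing2)

lemma q_int_le:
  assumes "0 \<le> q" "q < 1"
  shows "q_int q n \<le> 1 / (1 - q)"
proof -
  have "(1 - q) * q_int q n \<le> 1" using assms by (simp add: q_int_telescope)
  then show ?thesis using assms by (simp add: field_simps)
qed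

lemma q_int_tendsto:
  assumes "0 \<le> q" "q < 1"
  shows "q_int q \<longlonglongrightarrow> 1 / (1 - q)"
  using geometric_sums[of q] assms unfolding sums_def q_int_def by simp

lemma q_fact_0 [simp]: "q_fact q 0 = 1"
  by (simp add: q_fact_def)

lemma q_fact_Suc: "q_fact q (Suc n) = q_int q (Suc n) * q_fact q n"
  by (simp add: q_fact_def prod.nat_ivl_Suc' mult.commute)

lemma q_fact_pos: "0 \<le> q \<Longrightarrow> 0 < q_fact q n"
proof (induction n)
  case (Suc n)
  then show ?case using q_int_ge_1[of q n] by (auto simp: q_fact_Suc intro!: mult_pos_pos)
qed simp

section \<open>The defining equation of \<open>R\<^sub>q\<close>, on germs and on discs\<close>

lemma Rq_iff_times:
  assumes "f analytic_on {0}" "g analytic_on {0}" "q < 1"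
  shows "(\<forall>\<^sub>F z in at 0. g z = (f z - f (of_real q * z)) / ((1 - of_real q) * z)) \<longleftrightarrow>
         (\<forall>\<^sub>F z in nhds 0. (1 - of_real q) * (z * g z) = f z - f (of_real q * z))"
proof -
  have "1 - complex_of_real q \<noteq> 0" using assms(3) by (simp add: complex_eq_iff)
  then have "z \<noteq> 0 \<Longrightarrow> g z = (f z - f (of_real q * z)) / ((1 - of_real q) * z) \<longleftrightarrow>
      (1 - of_real q) * (z * g z) = f z - f (of_real q * z)" for z
    by (simp add: eq_divide_eq mult_ac)
  \<comment> \<open>At \<open>z = 0\<close> the equation without denominators reads
    \<open>0 = 0\<close>, so the punctured neighborhood may be filled in.\<close>
  then have "(z \<noteq> 0 \<longrightarrow> g z = (f z - f (of_real q * z)) / ((1 - of_real q) * z)) \<longleftrightarrow>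
      (1 - of_real q) * (z * g z) = f z - f (of_real q * z)" for z
    by (cases "z = 0") simp_all
  then show ?thesis unfolding eventually_at_filter by simp
qed

lemma Rq_iff_taylor_coeff:
  assumes f: "f analytic_on {0}" and g: "g analytic_on {0}" and q: "q < 1"
  shows "(\<forall>\<^sub>F z in at 0. g z = (f z - f (of_real q * z)) / ((1 - of_real q) * z)) \<longleftrightarrow>
         (\<forall>n. taylor_coeff g n = of_real (q_int q (Suc n)) * taylor_coeff f (Suc n))"
proof -
  let ?l = "\<lambda>z. (1 - complex_of_real q) * (z * g z)" and ?r = "\<lambda>z. f z - f (of_real q * z)"
  have nz: "1 - complex_of_real q \<noteq> 0" using q by (simp add: complex_eq_iff)
  have zg: "(\<lambda>z. z * g z) analytic_on {0}" by (intro analytic_intros g)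
  have an: "?l analytic_on {0}" "?r analytic_on {0}"
    by (intro analytic_intros g f taylor_coeff_dilate(2))+
  have "taylor_coeff ?l n = taylor_coeff ?r n \<longleftrightarrow>
      (1 - complex_of_real q) * (if n = 0 then 0 else taylor_coeff g (n - 1))
      = (1 - of_real q) * of_real (q_int q n) * taylor_coeff f n" for n
  proof -
    have "(1 - complex_of_real q) * of_real (q_int q n) = 1 - of_real q ^ n"
      using arg_cong[OF q_int_telescope[of q n], of complex_of_real] by simp
    then have "taylor_coeff ?r n = (1 - of_real q) * of_real (q_int q n) * taylor_coeff f n"
      using taylor_coeff_diff[OF f taylor_coeff_dilate(2)[OF f], of "of_real q" n]
        taylor_coeff_dilate(1)[OF f, of "of_real q" n] by (simp add: left_diff_distrib)
    moreover have "taylor_coeff ?l n = (1 - of_real q) * (if n = 0 then 0 else taylor_coeff g (n - 1))"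
      unfolding taylor_coeff_cmult[OF zg] taylor_coeff_times_id[OF g] ..
    ultimately show ?thesis by simp
  qed
  then have "(\<forall>n. taylor_coeff ?l n = taylor_coeff ?r n) \<longleftrightarrow>
      (\<forall>n. (1 - complex_of_real q) * (if n = 0 then 0 else taylor_coeff g (n - 1))
      = (1 - of_real q) * of_real (q_int q n) * taylor_coeff f n)" by simp
  \<comment> \<open>Index 0 gives \<open>0 = 0\<close>; index \<open>Suc n\<close> gives the
    recursion after cancelling \<open>1 - q\<close>.\<close>
  also have "\<dots> \<longleftrightarrow> (\<forall>n. taylor_coeff g n = of_real (q_int q (Suc n)) * taylor_coeff f (Suc n))"
    by (subst all_nat_iff) (use nz in \<open>simp add: mult.assoc\<close>)
  finally show ?thesis
    unfolding Rq_iff_times[OF f g q] eventually_eq_iff_taylor_coeff[OF an] .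
qed

text \<open>A disc around 0 is invariant under multiplication by \<open>q\<close>, so the identity
  theorem extends the equation from a germ to the disc. An equation at fixed points survives
  pointwise limits, which is how \<open>R\<^sub>q\<close> is shown to be closed.\<close>

lemma Rq_iff_ball:
  assumes f: "f holomorphic_on ball 0 r" and g: "g holomorphic_on ball 0 r"
    and q: "0 \<le> q" "q < 1" and r: "r > 0"
  shows "(\<forall>\<^sub>F z in at 0. g z = (f z - f (of_real q * z)) / ((1 - of_real q) * z)) \<longleftrightarrow>
         (\<forall>z\<in>ball 0 r. (1 - of_real q) * (z * g z) = f z - f (of_real q * z))"
proof -
  let ?l = "\<lambda>z. (1 - complex_of_real q) * (z * g z)" and ?r = "\<lambda>z. f z - f (of_real q * z)"
  have an: "f analytic_on {0}" "g analytic_on {0}"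
    using f g r by (auto intro: analytic_on_0I[where S = "ball 0 r"])
  have sub: "of_real q * z \<in> ball 0 r" if "z \<in> ball 0 r" for z :: complex
  proof -
    have "q * cmod z \<le> cmod z" using q by (simp add: mult_left_le_one_le)
    then show ?thesis using that q by (simp add: norm_mult)
  qed
  have "(f \<circ> (\<lambda>z. of_real q * z)) holomorphic_on ball 0 r"
    by (intro holomorphic_on_compose_gen[OF _ f] holomorphic_intros) (use sub in auto)
  then have hol: "?l holomorphic_on ball 0 r" "?r holomorphic_on ball 0 r"
    by (auto intro!: holomorphic_intros f g simp: o_def)
  then have anlr: "?l analytic_on {0}" "?r analytic_on {0}"
    using r by (auto intro: analytic_on_0I[where S = "ball 0 r"])
  have ev: "\<forall>\<^sub>F z in nhds (0::complex). z \<in> ball 0 r"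
    using r by (intro eventually_nhds_in_open) auto
  show ?thesis
    unfolding Rq_iff_times[OF an q(2)]
  proof
    assume *: "\<forall>\<^sub>F z in nhds 0. ?l z = ?r z"
    then have "\<And>n. taylor_coeff ?l n = taylor_coeff ?r n" by (rule taylor_coeff_cong)
    then show "\<forall>z\<in>ball 0 r. ?l z = ?r z"
      using holomorphic_eqI_taylor_coeff[OF hol] r by auto
  next
    assume "\<forall>z\<in>ball 0 r. ?l z = ?r z"
    with ev show "\<forall>\<^sub>F z in nhds 0. ?l z = ?r z" by (auto elim: eventually_mono)
  qed
qed

section \<open>The space \<open>H2q\<close>\<close>

context
  fixes w :: "nat \<Rightarrow> real"
  assumes w_pos: "\<And>n. 0 < w n"
begin

lemma summable_weighted_prod:
  fixes a b :: "nat \<Rightarrow> complex"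
  assumes "summable (\<lambda>n. w n * (cmod (a n))\<^sup>2)" "summable (\<lambda>n. w n * (cmod (b n))\<^sup>2)"
  shows "summable (\<lambda>n. of_real (w n) * a n * cnj (b n))"
proof (rule summable_comparison_test'[where N = 0])
  show "summable (\<lambda>n. w n * (cmod (a n))\<^sup>2 + w n * (cmod (b n))\<^sup>2)"
    by (intro summable_add assms)
  fix n
  have "0 \<le> cmod (a n) * cmod (b n)" by simp
  then have "cmod (a n) * cmod (b n) \<le> (cmod (a n))\<^sup>2 + (cmod (b n))\<^sup>2"
    using sum_squares_bound[of "cmod (a n)" "cmod (b n)"] by linarith
  then have "w n * (cmod (a n) * cmod (b n)) \<le> w n * ((cmod (a n))\<^sup>2 + (cmod (b n))\<^sup>2)"
    using w_pos[of n] by (intro mult_left_mono) auto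
  then show "norm (of_real (w n) * a n * cnj (b n)) \<le> w n * (cmod (a n))\<^sup>2 + w n * (cmod (b n))\<^sup>2"
    using w_pos[of n] by (simp add: norm_mult algebra_simps)
qed

lemma summable_weighted_add:
  fixes a b :: "nat \<Rightarrow> complex"
  assumes "summable (\<lambda>n. w n * (cmod (a n))\<^sup>2)" "summable (\<lambda>n. w n * (cmod (b n))\<^sup>2)"
  shows "summable (\<lambda>n. w n * (cmod (a n + b n))\<^sup>2)"
proof (rule summable_comparison_test'[where N = 0])
  show "summable (\<lambda>n. 2 * (w n * (cmod (a n))\<^sup>2) + 2 * (w n * (cmod (b n))\<^sup>2))"
    by (intro summable_add summable_mult assms)
  fix n
  have "(cmod (a n + b n))\<^sup>2 \<le> (cmod (a n) + cmod (b n))\<^sup>2"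
    by (intro power_mono norm_triangle_ineq) auto
  also have "\<dots> \<le> 2 * (cmod (a n))\<^sup>2 + 2 * (cmod (b n))\<^sup>2"
    using sum_squares_bound[of "cmod (a n)" "cmod (b n)"] by (simp add: power2_sum)
  finally have "w n * (cmod (a n + b n))\<^sup>2 \<le> w n * (2 * (cmod (a n))\<^sup>2 + 2 * (cmod (b n))\<^sup>2)"
    using w_pos[of n] by (intro mult_left_mono) auto
  then show "norm (w n * (cmod (a n + b n))\<^sup>2)
      \<le> 2 * (w n * (cmod (a n))\<^sup>2) + 2 * (w n * (cmod (b n))\<^sup>2)"
    using w_pos[of n] by (simp add: algebra_simps)
qed

lemma summable_weighted_cmult:
  fixes a :: "nat \<Rightarrow> complex"
  assumes "summable (\<lambda>n. w n * (cmod (a n))\<^sup>2)"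
  shows "summable (\<lambda>n. w n * (cmod (c * a n))\<^sup>2)"
  using summable_mult[OF assms, of "(cmod c)\<^sup>2"]
  by (simp add: norm_mult power_mult_distrib mult_ac)

lemma summable_weighted_diff:
  fixes a b :: "nat \<Rightarrow> complex"
  assumes "summable (\<lambda>n. w n * (cmod (a n))\<^sup>2)" "summable (\<lambda>n. w n * (cmod (b n))\<^sup>2)"
  shows "summable (\<lambda>n. w n * (cmod (a n - b n))\<^sup>2)"
  using summable_weighted_add[OF assms(1) summable_weighted_cmult[OF assms(2), of "-1"]] by simp

text \<open>Positive weights make each coordinate a Cauchy sequence. For finite sums over
  \<open>k < K\<close> the Cauchy estimate passes to the coordinatewise limit, and the bound is
  uniform in \<open>K\<close>.\<close>

lemma weighted_l2_complete:
  fixes a :: "nat \<Rightarrow> nat \<Rightarrow> complex"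
  assumes summ: "\<And>n. summable (\<lambda>k. w k * (cmod (a n k))\<^sup>2)"
    and cauchy: "\<And>e. e > 0 \<Longrightarrow> \<exists>N. \<forall>m\<ge>N. \<forall>n\<ge>N. (\<Sum>k. w k * (cmod (a m k - a n k))\<^sup>2) < e"
  obtains b where "summable (\<lambda>k. w k * (cmod (b k))\<^sup>2)"
    "(\<lambda>n. \<Sum>k. w k * (cmod (a n k - b k))\<^sup>2) \<longlonglongrightarrow> 0"
proof -
  have partial: "(\<Sum>k\<in>K. w k * (cmod (a m k - a n k))\<^sup>2) \<le> (\<Sum>k. w k * (cmod (a m k - a n k))\<^sup>2)"
    if "finite K" for K m n
    using w_pos by (intro sum_le_suminf summable_weighted_diff summ that) (simp add: less_imp_le)
  have "Cauchy (\<lambda>n. a n k)" for k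
  proof (rule metric_CauchyI)
    fix e :: real assume "e > 0"
    then have "w k * e\<^sup>2 > 0" using w_pos by simp
    from cauchy[OF this] obtain N where
      N: "\<And>m n. m \<ge> N \<Longrightarrow> n \<ge> N \<Longrightarrow> (\<Sum>k. w k * (cmod (a m k - a n k))\<^sup>2) < w k * e\<^sup>2" by blast
    have "dist (a m k) (a n k) < e" if "m \<ge> N" "n \<ge> N" for m n
    proof -
      have "w k * (cmod (a m k - a n k))\<^sup>2 < w k * e\<^sup>2"
        using partial[of "{k}" m n] N[OF that] by simp
      then have "(cmod (a m k - a n k))\<^sup>2 < e\<^sup>2" using w_pos[of k] by simp
      then show ?thesis using \<open>e > 0\<close> by (simp add: dist_norm power_less_imp_less_base)
    qed
    then show "\<exists>M. \<forall>m\<ge>M. \<forall>n\<ge>M. dist (a m k) (a n k) < e" by blast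
  qed
  then have "\<forall>k. \<exists>l. (\<lambda>n. a n k) \<longlonglongrightarrow> l" by (simp add: Cauchy_convergent convergent_def[symmetric])
  then obtain b where b: "\<And>k. (\<lambda>n. a n k) \<longlonglongrightarrow> b k" by metis
  have tail: "\<exists>N. \<forall>m\<ge>N. summable (\<lambda>k. w k * (cmod (a m k - b k))\<^sup>2) \<and>
      (\<Sum>k. w k * (cmod (a m k - b k))\<^sup>2) \<le> e" if "e > 0" for e
  proof -
    from cauchy[OF that] obtain N where
      N: "\<And>m n. m \<ge> N \<Longrightarrow> n \<ge> N \<Longrightarrow> (\<Sum>k. w k * (cmod (a m k - a n k))\<^sup>2) < e" by blast
    have le: "(\<Sum>k<K. w k * (cmod (a m k - b k))\<^sup>2) \<le> e" if "m \<ge> N" for m K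
    proof (rule LIMSEQ_le_const2)
      show "(\<lambda>n. \<Sum>k<K. w k * (cmod (a m k - a n k))\<^sup>2) \<longlonglongrightarrow> (\<Sum>k<K. w k * (cmod (a m k - b k))\<^sup>2)"
        by (intro tendsto_intros b)
      have "(\<Sum>k<K. w k * (cmod (a m k - a n k))\<^sup>2) \<le> e" if "n \<ge> N" for n
        using partial[of "{..<K}" m n] N[OF \<open>m \<ge> N\<close> that] by simp
      then show "\<exists>N. \<forall>n\<ge>N. (\<Sum>k<K. w k * (cmod (a m k - a n k))\<^sup>2) \<le> e" by blast
    qed
    show ?thesis
    proof (intro exI[of _ N] allI impI conjI)
      fix m assume m: "m \<ge> N"
      show s: "summable (\<lambda>k. w k * (cmod (a m k - b k))\<^sup>2)"
        by (rule summableI_nonneg_bounded[OF _ le[OF m]]) (simp add: w_pos less_imp_le)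
      show "(\<Sum>k. w k * (cmod (a m k - b k))\<^sup>2) \<le> e"
        by (rule suminf_le_const[OF s le[OF m]])
    qed
  qed
  show thesis
  proof (rule that)
    obtain m where "summable (\<lambda>k. w k * (cmod (a m k - b k))\<^sup>2)" using tail[of 1] by auto
    from summable_weighted_diff[OF summ[of m] this]
    show "summable (\<lambda>k. w k * (cmod (b k))\<^sup>2)" by simp
    show "(\<lambda>n. \<Sum>k. w k * (cmod (a n k - b k))\<^sup>2) \<longlonglongrightarrow> 0"
    proof (rule LIMSEQ_I)
      fix e :: real assume "e > 0"
      with tail[of "e / 2"] obtain N where
        N: "\<And>m. m \<ge> N \<Longrightarrow> summable (\<lambda>k. w k * (cmod (a m k - b k))\<^sup>2)"
        "\<And>m. m \<ge> N \<Longrightarrow> (\<Sum>k. w k * (cmod (a m k - b k))\<^sup>2) \<le> e / 2" by auto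
      have "norm ((\<Sum>k. w k * (cmod (a m k - b k))\<^sup>2) - 0) < e" if "m \<ge> N" for m
      proof -
        have "0 \<le> (\<Sum>k. w k * (cmod (a m k - b k))\<^sup>2)"
          by (intro suminf_nonneg N(1) that) (simp add: w_pos less_imp_le)
        then show ?thesis using N(2)[OF that] \<open>e > 0\<close> by simp
      qed
      then show "\<exists>N. \<forall>m\<ge>N. norm ((\<Sum>k. w k * (cmod (a m k - b k))\<^sup>2) - 0) < e" by blast
    qed
  qed
qed

end

section \<open>Power series on the disc of radius \<open>1 / sqrt (1 - q)\<close>\<close>

definition disc_fun :: "real \<Rightarrow> (nat \<Rightarrow> complex) \<Rightarrow> complex \<Rightarrow> complex"
  where "disc_fun q a z = (if z \<in> H2q_disc q then \<Sum>n. a n * z ^ n else 0)"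

context
  fixes q :: real
  assumes q: "0 \<le> q" "q < 1"
begin

lemma H2q_disc_radius_pos: "0 < 1 / sqrt (1 - q)"
  using q by simp

lemma H2q_disc_iff: "z \<in> H2q_disc q \<longleftrightarrow> cmod z < 1 / sqrt (1 - q)"
  by (simp add: H2q_disc_def)

lemma zero_in_H2q_disc: "0 \<in> H2q_disc q" and open_H2q_disc: "open (H2q_disc q)"
  and connected_H2q_disc: "connected (H2q_disc q)"
  using q by (auto simp: H2q_disc_def)

text \<open>Ratio test: the quotient of consecutive terms is \<open>r / q_int q (Suc n)\<close>,
  which tends to \<open>r * (1 - q) < 1\<close>.\<close>

lemma summable_E_q:
  assumes "0 \<le> r" "r < 1 / (1 - q)"
  shows "summable (\<lambda>n. r ^ n / q_fact q n)"
proof -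
  have "r * (1 - q) < 1" using assms q by (simp add: less_divide_eq)
  then obtain c where c: "r * (1 - q) < c" "c < 1" using dense by blast
  have "(\<lambda>n. r / q_int q (Suc n)) \<longlonglongrightarrow> r / (1 / (1 - q))"
    by (intro tendsto_intros LIMSEQ_Suc[OF q_int_tendsto] q) (use q in auto)
  then have "\<forall>\<^sub>F n in sequentially. r / q_int q (Suc n) < c"
    using c(1) by (intro order_tendstoD) auto
  then obtain N where N: "\<And>n. n \<ge> N \<Longrightarrow> r / q_int q (Suc n) < c"
    by (auto simp: eventually_sequentially)
  show ?thesis
  proof (rule summable_ratio_test[OF c(2)])
    fix n assume "n \<ge> N"
    have "norm (r ^ Suc n / q_fact q (Suc n)) = r / q_int q (Suc n) * norm (r ^ n / q_fact q n)"
      using assms(1) q_fact_pos[OF q(1), of n] q_int_ge_1[OF q(1), of n]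
      by (simp add: q_fact_Suc)
    also have "\<dots> \<le> c * norm (r ^ n / q_fact q n)"
      using N[OF \<open>n \<ge> N\<close>] by (intro mult_right_mono) auto
    finally show "norm (r ^ Suc n / q_fact q (Suc n)) \<le> c * norm (r ^ n / q_fact q n)" .
  qed
qed

lemma H2q_disc_sq: "z \<in> H2q_disc q \<Longrightarrow> (cmod z)\<^sup>2 < 1 / (1 - q)"
proof -
  assume "z \<in> H2q_disc q"
  then have "(cmod z)\<^sup>2 < (1 / sqrt (1 - q))\<^sup>2"
    by (intro power_strict_mono) (auto simp: H2q_disc_iff)
  then show ?thesis using q by (simp add: power_divide)
qed

text \<open>By the inequality \<open>|a\<^sub>n z\<^sup>n| \<le> [n]! |a\<^sub>n|\<^sup>2 + |z|\<^sup>2\<^sup>n / [n]!\<close>.\<close>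

lemma summable_powser_H2q:
  assumes a: "summable (\<lambda>n. q_fact q n * (cmod (a n))\<^sup>2)" and z: "z \<in> H2q_disc q"
  shows "summable (\<lambda>n. a n * z ^ n)"
proof (rule summable_comparison_test'[where N = 0])
  show "summable (\<lambda>n. q_fact q n * (cmod (a n))\<^sup>2 + ((cmod z)\<^sup>2) ^ n / q_fact q n)"
    by (intro summable_add a summable_E_q H2q_disc_sq z) auto
  fix n
  let ?s = "sqrt (q_fact q n)"
  have pos: "?s > 0" "?s\<^sup>2 = q_fact q n" using q_fact_pos[OF q(1), of n] by auto
  have "2 * (?s * cmod (a n)) * (cmod z ^ n / ?s) \<le> (?s * cmod (a n))\<^sup>2 + (cmod z ^ n / ?s)\<^sup>2"
    by (rule sum_squares_bound)
  then have "2 * (cmod (a n) * cmod z ^ n) \<le> q_fact q n * (cmod (a n))\<^sup>2 + ((cmod z)\<^sup>2) ^ n / q_fact q n"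
    using pos by (simp add: power_mult_distrib power_divide flip: power_mult) (simp add: mult.commute)
  moreover have "0 \<le> cmod (a n) * cmod z ^ n" by simp
  ultimately have "cmod (a n) * cmod z ^ n \<le> q_fact q n * (cmod (a n))\<^sup>2 + ((cmod z)\<^sup>2) ^ n / q_fact q n"
    by linarith
  then show "norm (a n * z ^ n) \<le> q_fact q n * (cmod (a n))\<^sup>2 + ((cmod z)\<^sup>2) ^ n / q_fact q n"
    by (simp add: norm_mult norm_power)
qed

lemma disc_fun_sums:
  assumes "summable (\<lambda>n. q_fact q n * (cmod (a n))\<^sup>2)" "z \<in> H2q_disc q"
  shows "(\<lambda>n. a n * z ^ n) sums disc_fun q a z"
  using summable_sums[OF summable_powser_H2q[OF assms]] assms(2) by (simp add: disc_fun_def)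

lemma disc_fun_holomorphic:
  assumes "summable (\<lambda>n. q_fact q n * (cmod (a n))\<^sup>2)"
  shows "disc_fun q a holomorphic_on H2q_disc q"
  unfolding H2q_disc_def
  by (rule power_series_holomorphic) (use disc_fun_sums[OF assms] in \<open>simp add: H2q_disc_def\<close>)

lemma taylor_coeff_disc_fun:
  assumes "summable (\<lambda>n. q_fact q n * (cmod (a n))\<^sup>2)"
  shows "taylor_coeff (disc_fun q a) n = a n"
  by (rule taylor_coeff_of_sums[OF _ H2q_disc_radius_pos])
    (use disc_fun_sums[OF assms] in \<open>simp add: H2q_disc_iff\<close>)

lemma disc_fun_mem:
  assumes "summable (\<lambda>n. q_fact q n * (cmod (a n))\<^sup>2)"
  shows "disc_fun q a \<in> H2q q"
  using assms disc_fun_holomorphic[OF assms]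
  by (simp add: H2q_def taylor_coeff_disc_fun) (simp add: disc_fun_def)

section \<open>\<open>H2q\<close> as a reproducing kernel Hilbert space\<close>

lemma H2q_summable: "f \<in> H2q q \<Longrightarrow> summable (\<lambda>n. q_fact q n * (cmod (taylor_coeff f n))\<^sup>2)"
  by (simp add: H2q_def)

lemma H2q_analytic: "f \<in> H2q q \<Longrightarrow> f analytic_on {0}"
  using analytic_on_0I[OF _ open_H2q_disc zero_in_H2q_disc] by (simp add: H2q_def)

lemma H2q_eqI:
  assumes "f \<in> H2q q" "g \<in> H2q q" "\<And>n. taylor_coeff f n = taylor_coeff g n"
  shows "f = g"
proof
  fix z
  show "f z = g z"
  proof (cases "z \<in> H2q_disc q")
    case True
    with assms show ?thesis
      using holomorphic_eqI_taylor_coeff[OF _ _ open_H2q_disc connected_H2q_disc zero_in_H2q_disc]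
      by (auto simp: H2q_def)
  next
    case False
    with assms show ?thesis by (simp add: H2q_def)
  qed
qed

lemma H2q_sums: "f \<in> H2q q \<Longrightarrow> z \<in> H2q_disc q \<Longrightarrow> (\<lambda>n. taylor_coeff f n * z ^ n) sums f z"
  by (rule taylor_coeff_sums[where r = "1 / sqrt (1 - q)"])
    (simp_all add: H2q_def H2q_disc_def)

lemma H2q_inner_summable:
  "f \<in> H2q q \<Longrightarrow> g \<in> H2q q \<Longrightarrow>
   summable (\<lambda>n. of_real (q_fact q n) * taylor_coeff f n * cnj (taylor_coeff g n))"
  by (intro summable_weighted_prod H2q_summable q_fact_pos q)

lemma H2q_inner_self:
  assumes "f \<in> H2q q"
  shows "H2q_inner q f f = of_real (\<Sum>n. q_fact q n * (cmod (taylor_coeff f n))\<^sup>2)"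
proof -
  have "H2q_inner q f f = (\<Sum>n. of_real (q_fact q n * (cmod (taylor_coeff f n))\<^sup>2))"
    unfolding H2q_inner_def
    by (simp flip: complex_norm_square add: mult.assoc)
  also have "\<dots> = of_real (\<Sum>n. q_fact q n * (cmod (taylor_coeff f n))\<^sup>2)"
    by (rule suminf_of_real[symmetric]) (rule H2q_summable[OF assms])
  finally show ?thesis .
qed

lemma H2q_zero: "(\<lambda>z. 0) \<in> H2q q"
  by (simp add: H2q_def)

lemma H2q_add:
  assumes "f \<in> H2q q" "g \<in> H2q q"
  shows "(\<lambda>z. f z + g z) \<in> H2q q"
  using summable_weighted_add[OF q_fact_pos[OF q(1)] assms[THEN H2q_summable]] assms
  by (simp add: H2q_def taylor_coeff_add assms[THEN H2q_analytic] holomorphic_on_add)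

lemma H2q_scale:
  assumes "f \<in> H2q q"
  shows "(\<lambda>z. c * f z) \<in> H2q q"
  using summable_weighted_cmult[OF q_fact_pos[OF q(1)] H2q_summable[OF assms], of c] assms
  by (simp add: H2q_def taylor_coeff_cmult H2q_analytic[OF assms] holomorphic_intros)

lemma H2q_analytic_hilbert_space: "analytic_hilbert_space (H2q_disc q) (H2q q) (H2q_inner q)"
proof
  show "open (H2q_disc q)" "connected (H2q_disc q)" "0 \<in> H2q_disc q"
    by (fact open_H2q_disc connected_H2q_disc zero_in_H2q_disc)+
next
  fix f g h assume H: "f \<in> H2q q" "g \<in> H2q q" "h \<in> H2q q"
  show "H2q_inner q (\<lambda>z. f z + g z) h = H2q_inner q f h + H2q_inner q g h"
    using suminf_add[OF H2q_inner_summable[OF H(1,3)] H2q_inner_summable[OF H(2,3)]]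
    by (simp add: H2q_inner_def taylor_coeff_add H[THEN H2q_analytic] ring_distribs)
next
  fix c f h assume H: "f \<in> H2q q" "h \<in> H2q q"
  show "H2q_inner q (\<lambda>z. c * f z) h = c * H2q_inner q f h"
    using suminf_mult[OF H2q_inner_summable[OF H], of c]
    by (simp add: H2q_inner_def taylor_coeff_cmult H[THEN H2q_analytic] mult_ac)
next
  fix f g assume H: "f \<in> H2q q" "g \<in> H2q q"
  have "(\<lambda>n. cnj (of_real (q_fact q n) * taylor_coeff f n * cnj (taylor_coeff g n))) sums
      cnj (H2q_inner q f g)"
    unfolding sums_cnj H2q_inner_def by (rule summable_sums[OF H2q_inner_summable[OF H]])
  from sums_unique[OF this] show "H2q_inner q g f = cnj (H2q_inner q f g)"
    by (simp add: H2q_inner_def mult_ac)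
next
  fix f assume f: "f \<in> H2q q"
  have nonneg: "0 \<le> q_fact q n * (cmod (taylor_coeff f n))\<^sup>2" for n
    using q_fact_pos[OF q(1), of n] by simp
  then show "0 \<le> Re (H2q_inner q f f)"
    using suminf_nonneg[OF H2q_summable[OF f]] by (simp add: H2q_inner_self[OF f])
  assume "H2q_inner q f f = 0"
  then have "(\<Sum>n. q_fact q n * (cmod (taylor_coeff f n))\<^sup>2) = 0"
    unfolding H2q_inner_self[OF f] by (simp only: of_real_eq_0_iff)
  then have "\<forall>n. q_fact q n * (cmod (taylor_coeff f n))\<^sup>2 = 0"
    using suminf_eq_zero_iff[OF H2q_summable[OF f] nonneg] by simp
  then have "taylor_coeff f n = 0" for n
    using q_fact_pos[OF q(1), of n] by (metis less_irrefl mult_eq_0_iff norm_eq_zero zero_eq_power2)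
  then show "f = (\<lambda>z. 0)" by (intro H2q_eqI f H2q_zero) simp
next
  fix X :: "nat \<Rightarrow> complex \<Rightarrow> complex"
  assume X: "\<And>n. X n \<in> H2q q"
    and cauchy: "\<And>e. e > 0 \<Longrightarrow>
      \<exists>N. \<forall>m\<ge>N. \<forall>n\<ge>N. ip_norm (H2q_inner q) (\<lambda>z. X m z - X n z) < e"
  have norm_eq: "ip_norm (H2q_inner q) (\<lambda>z. f z - g z) =
      sqrt (\<Sum>k. q_fact q k * (cmod (taylor_coeff f k - taylor_coeff g k))\<^sup>2)"
    if "f \<in> H2q q" "g \<in> H2q q" for f g
  proof -
    have "(\<lambda>z. f z - g z) \<in> H2q q" using H2q_add[OF that(1) H2q_scale[OF that(2), of "-1"]] by simp
    from H2q_inner_self[OF this] show ?thesis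
      by (simp add: ip_norm_def taylor_coeff_diff that[THEN H2q_analytic])
  qed
  \<comment> \<open>The limit of the coefficient sequences supplies the coefficients of the limit
    function \<open>disc_fun q b\<close>.\<close>
  obtain b where b: "summable (\<lambda>k. q_fact q k * (cmod (b k))\<^sup>2)"
    and lim: "(\<lambda>n. \<Sum>k. q_fact q k * (cmod (taylor_coeff (X n) k - b k))\<^sup>2) \<longlonglongrightarrow> 0"
  proof (rule weighted_l2_complete[where w = "q_fact q" and a = "\<lambda>n. taylor_coeff (X n)"])
    show "\<exists>N. \<forall>m\<ge>N. \<forall>n\<ge>N.
        (\<Sum>k. q_fact q k * (cmod (taylor_coeff (X m) k - taylor_coeff (X n) k))\<^sup>2) < e"
      if "e > 0" for e
      using cauchy[of "sqrt e"] that by (simp add: norm_eq X)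
  qed (use q_fact_pos[OF q(1)] H2q_summable[OF X] in auto)
  have "(\<lambda>n. ip_norm (H2q_inner q) (\<lambda>z. X n z - disc_fun q b z)) \<longlonglongrightarrow> 0"
    using tendsto_real_sqrt[OF lim]
    by (simp add: norm_eq X disc_fun_mem[OF b] taylor_coeff_disc_fun[OF b])
  then show "\<exists>f\<in>H2q q. (\<lambda>n. ip_norm (H2q_inner q) (\<lambda>z. X n z - f z)) \<longlonglongrightarrow> 0"
    using disc_fun_mem[OF b] by blast
qed (use H2q_zero H2q_add H2q_scale in \<open>auto simp: H2q_def\<close>)

text \<open>The kernel function at \<open>w\<close> has coefficients
  \<open>cnj w ^ n / q_fact q n\<close>. The weights of the inner product cancel the denominators
  and leave the Taylor series of \<open>f\<close> at \<open>w\<close>; the squared norm is the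
  series of \<open>E_q\<close> at \<open>(cmod w)\<^sup>2 < 1 / (1 - q)\<close>.\<close>

lemma H2q_reproducing_kernel:
  "has_reproducing_kernel (H2q_disc q) (H2q q) (H2q_inner q) (\<lambda>z w. E_q q (z * cnj w))"
  unfolding has_reproducing_kernel_def
proof (intro ballI conjI)
  fix w assume w: "w \<in> H2q_disc q"
  let ?k = "\<lambda>z. if z \<in> H2q_disc q then E_q q (z * cnj w) else 0"
  let ?a = "\<lambda>n. cnj w ^ n / of_real (q_fact q n)"
  have k_eq: "?k = disc_fun q ?a"
    by (simp add: fun_eq_iff disc_fun_def E_q_def power_mult_distrib mult.commute)
  have "q_fact q n * (cmod (?a n))\<^sup>2 = ((cmod w)\<^sup>2) ^ n / q_fact q n" for n
    using q_fact_pos[OF q(1), of n]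
    by (simp add: norm_divide norm_power power_divide flip: power_mult)
      (simp add: power2_eq_square mult.commute)
  then have a: "summable (\<lambda>n. q_fact q n * (cmod (?a n))\<^sup>2)"
    using summable_E_q[OF _ H2q_disc_sq[OF w]] by simp
  show "?k \<in> H2q q" unfolding k_eq by (rule disc_fun_mem[OF a])
  fix f assume f: "f \<in> H2q q"
  have "of_real (q_fact q n) * taylor_coeff f n * cnj (?a n) = taylor_coeff f n * w ^ n" for n
    using q_fact_pos[OF q(1), of n] by simp
  then show "f w = H2q_inner q f ?k"
    unfolding k_eq H2q_inner_def taylor_coeff_disc_fun[OF a]
    using sums_unique[OF H2q_sums[OF f w]] by simp
qed

section \<open>The operators \<open>R\<^sub>q\<close> and \<open>M\<^sub>z\<close> on
  \<open>H2q\<close>\<close>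

lemma H2q_Rq_graph_iff:
  "(f, g) \<in> Rq_graph q (H2q q) \<longleftrightarrow> f \<in> H2q q \<and> g \<in> H2q q \<and>
     (\<forall>n. taylor_coeff g n = of_real (q_int q (Suc n)) * taylor_coeff f (Suc n))"
  using Rq_iff_taylor_coeff[OF H2q_analytic H2q_analytic q(2), of f g]
  by (auto simp: Rq_graph_def)

text \<open>One of the two factors \<open>q_int q (Suc n)\<close> raises the weight to
  \<open>q_fact q (Suc n)\<close>, and the other is at most \<open>1 / (1 - q)\<close>. So
  \<open>R\<^sub>q\<close> is bounded on \<open>H2q\<close>.\<close>

lemma H2q_Rq_total:
  assumes f: "f \<in> H2q q"
  obtains g where "(f, g) \<in> Rq_graph q (H2q q)"
proof -
  let ?a = "\<lambda>n. of_real (q_int q (Suc n)) * taylor_coeff f (Suc n)"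
  have "summable (\<lambda>n. q_fact q n * (cmod (?a n))\<^sup>2)"
  proof (rule summable_comparison_test'[where N = 0])
    show "summable (\<lambda>n. 1 / (1 - q) * (q_fact q (Suc n) * (cmod (taylor_coeff f (Suc n)))\<^sup>2))"
      using H2q_summable[OF f]
      by (intro summable_mult)
        (subst summable_Suc_iff[of "\<lambda>n. q_fact q n * (cmod (taylor_coeff f n))\<^sup>2"])
    fix n
    have "q_fact q n * (cmod (?a n))\<^sup>2
        = q_int q (Suc n) * (q_fact q (Suc n) * (cmod (taylor_coeff f (Suc n)))\<^sup>2)"
      by (simp add: norm_mult power_mult_distrib q_fact_Suc) (simp add: power2_eq_square)
    also have "\<dots> \<le> 1 / (1 - q) * (q_fact q (Suc n) * (cmod (taylor_coeff f (Suc n)))\<^sup>2)"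
      using q_fact_pos[OF q(1), of "Suc n"] by (intro mult_right_mono q_int_le q) auto
    finally show "norm (q_fact q n * (cmod (?a n))\<^sup>2)
        \<le> 1 / (1 - q) * (q_fact q (Suc n) * (cmod (taylor_coeff f (Suc n)))\<^sup>2)"
      using q_fact_pos[OF q(1), of n] by simp
  qed
  then show thesis
    using that[of "disc_fun q ?a"] f
    by (simp add: H2q_Rq_graph_iff disc_fun_mem taylor_coeff_disc_fun)
qed

text \<open>The shift multiplies the weight of the \<open>n\<close>-th coefficient by
  \<open>q_int q (Suc n)\<close>, which is at most \<open>1 / (1 - q)\<close>.\<close>

lemma H2q_mult_id:
  assumes f: "f \<in> H2q q"
  shows "(\<lambda>z. z * f z) \<in> H2q q"
proof -
  let ?c = "taylor_coeff (\<lambda>z. z * f z)"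
  have tc: "?c 0 = 0" "?c (Suc n) = taylor_coeff f n" for n
    by (simp_all add: taylor_coeff_times_id[OF H2q_analytic[OF f]])
  have "summable (\<lambda>n. q_fact q (Suc n) * (cmod (?c (Suc n)))\<^sup>2)"
  proof (rule summable_comparison_test'[where N = 0])
    show "summable (\<lambda>n. 1 / (1 - q) * (q_fact q n * (cmod (taylor_coeff f n))\<^sup>2))"
      by (intro summable_mult H2q_summable q f)
    fix n
    have "q_int q (Suc n) * (q_fact q n * (cmod (taylor_coeff f n))\<^sup>2)
        \<le> 1 / (1 - q) * (q_fact q n * (cmod (taylor_coeff f n))\<^sup>2)"
      using q_fact_pos[OF q(1), of n] by (intro mult_right_mono q_int_le q) auto
    then show "norm (q_fact q (Suc n) * (cmod (?c (Suc n)))\<^sup>2)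
        \<le> 1 / (1 - q) * (q_fact q n * (cmod (taylor_coeff f n))\<^sup>2)"
      using q_fact_pos[OF q(1), of "Suc n"] by (simp add: tc q_fact_Suc)
  qed
  then have "summable (\<lambda>n. q_fact q n * (cmod (?c n))\<^sup>2)"
    by (subst (asm) summable_Suc_iff)
  with f show ?thesis by (auto simp: H2q_def intro!: holomorphic_intros)
qed

lemma H2q_domains: "Domain (Rq_graph q (H2q q)) = H2q q" "Domain (Mz_graph (H2q q)) = H2q q"
proof -
  show "Domain (Rq_graph q (H2q q)) = H2q q"
  proof (intro equalityI subsetI)
    fix f assume "f \<in> H2q q"
    then obtain g where "(f, g) \<in> Rq_graph q (H2q q)" by (rule H2q_Rq_total)
    then show "f \<in> Domain (Rq_graph q (H2q q))" by (rule DomainI)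
  qed (auto simp: Rq_graph_def)
  show "Domain (Mz_graph (H2q q)) = H2q q"
    using H2q_mult_id by (auto simp: Mz_graph_def)
qed

text \<open>An adjoint pair is tested on monomials, which determines every coefficient of
  \<open>h\<close>. Conversely, \<open>M\<^sub>z\<close> satisfies the adjoint relation by an index
  shift in the series of the inner product.\<close>

lemma H2q_adjoint: "adjoint_graph (H2q q) (H2q_inner q) (Rq_graph q (H2q q)) = Mz_graph (H2q q)"
proof (intro set_eqI iffI; clarify)
  fix g h assume "(g, h) \<in> adjoint_graph (H2q q) (H2q_inner q) (Rq_graph q (H2q q))"
  then have gh: "g \<in> H2q q" "h \<in> H2q q" and
    adj: "\<And>f f'. (f, f') \<in> Rq_graph q (H2q q) \<Longrightarrow> H2q_inner q f' g = H2q_inner q f h"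
    unfolding adjoint_graph_def by auto
  let ?e = "\<lambda>k n. if n = k then 1 else (0::complex)"
  have e: "summable (\<lambda>n. q_fact q n * (cmod (c * ?e k n))\<^sup>2)" for c k
    by (rule summable_finite[of "{k}"]) auto
  \<comment> \<open>\<open>?m c k\<close> is the monomial \<open>c * z ^ k\<close> on the disc;
    pairing with it isolates the \<open>k\<close>-th coefficient.\<close>
  let ?m = "\<lambda>c k. disc_fun q (\<lambda>n. c * ?e k n)"
  have m: "?m c k \<in> H2q q" for c k by (rule disc_fun_mem[OF e])
  have inner_m: "H2q_inner q (?m c k) f = c * of_real (q_fact q k) * cnj (taylor_coeff f k)" for c k f
  proof -
    have "(\<lambda>n. of_real (q_fact q n) * (c * ?e k n) * cnj (taylor_coeff f n)) =
        (\<lambda>n. if n = k then c * of_real (q_fact q k) * cnj (taylor_coeff f k) else 0)"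
      by (auto simp: fun_eq_iff)
    then show ?thesis
      unfolding H2q_inner_def taylor_coeff_disc_fun[OF e]
      using sums_unique[OF sums_single[of k "\<lambda>n. c * of_real (q_fact q k) * cnj (taylor_coeff f k)"]]
      by simp
  qed
  have "taylor_coeff h n = taylor_coeff (\<lambda>z. z * g z) n" for n
  proof (cases n)
    case 0
    \<comment> \<open>\<open>R\<^sub>q\<close> annihilates constants, which forces
      \<open>h 0 = 0\<close>.\<close>
    have "(?m 1 0, \<lambda>z. 0) \<in> Rq_graph q (H2q q)"
      using m[of 1 0] H2q_zero taylor_coeff_disc_fun[OF e, of 1 0] by (simp add: H2q_Rq_graph_iff)
    from adj[OF this] have "taylor_coeff h 0 = 0"
      unfolding inner_m by (simp add: H2q_inner_def)
    then show ?thesis using 0 by (simp add: taylor_coeff_times_id[OF H2q_analytic[OF gh(1)]])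
  next
    case (Suc k)
    \<comment> \<open>\<open>R\<^sub>q\<close> maps \<open>z ^ Suc k\<close> to
      \<open>q_int q (Suc k) * z ^ k\<close>.\<close>
    have "(?m 1 (Suc k), ?m (of_real (q_int q (Suc k))) k) \<in> Rq_graph q (H2q q)"
      unfolding H2q_Rq_graph_iff taylor_coeff_disc_fun[OF e]
      using m[of 1 "Suc k"] m[of "of_real (q_int q (Suc k))" k] by simp
    from adj[OF this] have "cnj (taylor_coeff g k) = cnj (taylor_coeff h (Suc k))"
      unfolding inner_m using q_fact_pos[OF q(1), of k] q_int_ge_1[OF q(1), of k]
      by (simp add: q_fact_Suc)
    then show ?thesis using Suc by (simp add: taylor_coeff_times_id[OF H2q_analytic[OF gh(1)]])
  qed
  then have "h = (\<lambda>z. z * g z)" by (intro H2q_eqI gh H2q_mult_id)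
  then show "(g, h) \<in> Mz_graph (H2q q)" using gh by (simp add: Mz_graph_def)
next
  fix g h assume "(g, h) \<in> Mz_graph (H2q q)"
  then have g: "g \<in> H2q q" and h: "h \<in> H2q q" "h = (\<lambda>z. z * g z)" by (auto simp: Mz_graph_def)
  have tc: "taylor_coeff h 0 = 0" "\<And>n. taylor_coeff h (Suc n) = taylor_coeff g n"
    by (simp_all add: h(2) taylor_coeff_times_id[OF H2q_analytic[OF g]])
  have "H2q_inner q f' g = H2q_inner q f h" if "(f, f') \<in> Rq_graph q (H2q q)" for f f'
  proof -
    have f: "f \<in> H2q q" using that by (simp add: H2q_Rq_graph_iff)
    have f': "taylor_coeff f' n = of_real (q_int q (Suc n)) * taylor_coeff f (Suc n)" for n
      using that by (simp add: H2q_Rq_graph_iff)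
    have "H2q_inner q f h = (\<Sum>n. of_real (q_fact q (Suc n)) * taylor_coeff f (Suc n) * cnj (taylor_coeff h (Suc n)))"
      unfolding H2q_inner_def using suminf_split_head[OF H2q_inner_summable[OF f h(1)]] tc(1) by simp
    also have "\<dots> = H2q_inner q f' g"
      unfolding H2q_inner_def by (simp add: tc f' q_fact_Suc mult_ac)
    finally show ?thesis ..
  qed
  then show "(g, h) \<in> adjoint_graph (H2q q) (H2q_inner q) (Rq_graph q (H2q q))"
    using g h(1) by (auto simp: adjoint_graph_def)
qed

lemma H2q_nontrivial: "H2q q \<noteq> {\<lambda>z. 0}"
proof
  assume *: "H2q q = {\<lambda>z. 0}"
  let ?a = "\<lambda>n. if n = 0 then 1 else (0::complex)"
  have a: "summable (\<lambda>n. q_fact q n * (cmod (?a n))\<^sup>2)"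
    by (rule summable_finite[of "{0}"]) auto
  have "disc_fun q ?a = (\<lambda>z. 0)" using disc_fun_mem[OF a] * by blast
  then show False using taylor_coeff_disc_fun[OF a, of 0] by simp
qed

end

section \<open>Uniqueness\<close>

text \<open>Only completeness needs an argument: one locale states it with the norm, the other with
  its square.\<close>

sublocale analytic_hilbert_space \<subseteq> hilb: hilbert_function_space H ip
proof
  fix X :: "nat \<Rightarrow> complex \<Rightarrow> complex"
  assume X: "\<And>n. X n \<in> H"
    and cauchy: "\<And>e. e > 0 \<Longrightarrow> \<exists>N. \<forall>m\<ge>N. \<forall>n\<ge>N.
      Re (ip (\<lambda>z. X m z - X n z) (\<lambda>z. X m z - X n z)) < e"
  have "\<exists>f\<in>H. (\<lambda>n. ip_norm ip (\<lambda>z. X n z - f z)) \<longlonglongrightarrow> 0"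
  proof (rule complete[OF X])
    fix e :: real assume "e > 0"
    have "ip_norm ip f < e" if "Re (ip f f) < e\<^sup>2" for f
      using real_sqrt_less_mono[OF that] \<open>e > 0\<close> by (simp add: ip_norm_def)
    then show "\<exists>N. \<forall>m\<ge>N. \<forall>n\<ge>N. ip_norm ip (\<lambda>z. X m z - X n z) < e"
      using cauchy[of "e\<^sup>2"] \<open>e > 0\<close> zero_less_power[of e 2] by blast
  qed
  then obtain f where f: "f \<in> H" "(\<lambda>n. ip_norm ip (\<lambda>z. X n z - f z)) \<longlonglongrightarrow> 0" by blast
  have "(\<lambda>z. X n z - f z) \<in> H" for n
    using add_mem[OF X scale_mem[OF f(1)], of n "-1"] by simp
  then have "(ip_norm ip (\<lambda>z. X n z - f z))\<^sup>2 = Re (ip (\<lambda>z. X n z - f z) (\<lambda>z. X n z - f z))" for n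
    using ip_nonneg by (simp add: ip_norm_def)
  then have "(\<lambda>n. Re (ip (\<lambda>z. X n z - f z) (\<lambda>z. X n z - f z))) \<longlonglongrightarrow> 0"
    using tendsto_power[OF f(2), of 2] by simp
  with f(1) show "\<exists>f\<in>H. (\<lambda>n. Re (ip (\<lambda>z. X n z - f z) (\<lambda>z. X n z - f z))) \<longlonglongrightarrow> 0" by blast
qed (fact zero_mem add_mem scale_mem ip_add ip_scale ip_cnj ip_nonneg)+

context analytic_hilbert_space
begin

section \<open>Monomials and Taylor coefficients in \<open>H\<close>\<close>

lemma analytic_0: "f \<in> H \<Longrightarrow> f analytic_on {0}"
  using analytic_on_0I[OF analytic domain(1,3)] .

lemma eq_on_outsideI:
  assumes "f holomorphic_on \<Omega>" "g holomorphic_on \<Omega>" "\<And>n. taylor_coeff f n = taylor_coeff g n"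
    and "\<And>z. z \<notin> \<Omega> \<Longrightarrow> f z = g z"
  shows "f = g"
proof
  fix z
  show "f z = g z"
    using holomorphic_eqI_taylor_coeff[OF assms(1,2) domain(1,2,3) _ assms(3)] assms(4)
    by (cases "z \<in> \<Omega>") auto
qed

lemma eqI_taylor_coeff:
  assumes "f \<in> H" "g \<in> H" "\<And>n. taylor_coeff f n = taylor_coeff g n"
  shows "f = g"
  using eq_on_outsideI[OF analytic[OF assms(1)] analytic[OF assms(2)] assms(3)]
    outside[OF assms(1)] outside[OF assms(2)] by simp

text \<open>Cut off outside \<open>\<Omega>\<close> to follow the convention for elements of
  \<open>H\<close>. Membership in \<open>H\<close> is established separately in each of the two
  uniqueness arguments.\<close>

definition monom_fun :: "nat \<Rightarrow> complex \<Rightarrow> complex"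
  where "monom_fun n z = (if z \<in> \<Omega> then z ^ n else 0)"

lemma taylor_coeff_monom_fun: "taylor_coeff (monom_fun k) n = (if n = k then 1 else 0)"
proof (rule taylor_coeff_monomial)
  have "\<forall>\<^sub>F z in nhds 0. z \<in> \<Omega>" using domain by (intro eventually_nhds_in_open)
  then show "\<forall>\<^sub>F z in nhds 0. monom_fun k z = z ^ k"
    by eventually_elim (simp add: monom_fun_def)
qed

lemma Rq_graph_iff:
  assumes "q < 1"
  shows "(f, g) \<in> Rq_graph q H \<longleftrightarrow> f \<in> H \<and> g \<in> H \<and>
     (\<forall>n. taylor_coeff g n = of_real (q_int q (Suc n)) * taylor_coeff f (Suc n))"
  using Rq_iff_taylor_coeff[OF analytic_0 analytic_0 assms, of f g]
  by (auto simp: Rq_graph_def)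

text \<open>The common end of both uniqueness arguments: under \<open>repr\<close> the monomials are
  orthogonal with squared norms \<open>c * q_fact q n\<close>.\<close>

theorem equals_H2q_if_taylor_coeff_represented:
  assumes q: "0 \<le> q" "q < 1" and c: "c > 0"
    and mem: "\<And>n. monom_fun n \<in> H"
    and repr: "\<And>f n. f \<in> H \<Longrightarrow> ip f (monom_fun n) = of_real (c * q_fact q n) * taylor_coeff f n"
  shows "equals_H2q_up_to_factor q H ip"
proof -
  define P where "P a A = (\<lambda>z. \<Sum>n\<in>A. a n * monom_fun n z)" for a and A :: "nat set"
  have P_mem: "P a A \<in> H" for a A
    unfolding P_def by (intro hilb.sum_mem scale_mem mem)
  have ip_P_left: "ip (P a A) f = of_real c * (\<Sum>n\<in>A. of_real (q_fact q n) * a n * cnj (taylor_coeff f n))"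
    if "f \<in> H" for a A f
  proof -
    have "ip (\<lambda>z. a n * monom_fun n z) f = of_real c * (of_real (q_fact q n) * a n * cnj (taylor_coeff f n))" for n
      using ip_scale[OF mem that, of "a n" n] ip_cnj[OF that mem, of n] repr[OF that, of n] by simp
    then show ?thesis
      unfolding P_def by (simp add: hilb.ip_sum[OF scale_mem[OF mem] that] sum_distrib_left)
  qed
  \<comment> \<open>\<open>repr\<close> allows the coefficients of the polynomial to be read off
    from inner products.\<close>
  have tc_P: "taylor_coeff (P a A) k = (if k \<in> A then a k else 0)" if "finite A" for a A k
  proof -
    have "of_real (c * q_fact q k) * taylor_coeff (P a A) k = ip (P a A) (monom_fun k)"
      by (rule repr[OF P_mem, symmetric])
    also have "\<dots> = of_real c * (\<Sum>n\<in>A. if n = k then of_real (q_fact q k) * a k else 0)"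
      unfolding ip_P_left[OF mem] taylor_coeff_monom_fun
      by (intro arg_cong2[of _ _ _ _ times] sum.cong) auto
    also have "\<dots> = of_real (c * q_fact q k) * (if k \<in> A then a k else 0)"
      using that by simp
    finally show ?thesis using c q_fact_pos[OF q(1), of k] by simp
  qed
  have sqn_P: "Re (ip (P a A) (P a A)) = c * (\<Sum>n\<in>A. q_fact q n * (cmod (a n))\<^sup>2)" if "finite A" for a A
  proof -
    have "ip (P a A) (P a A) = of_real (c * (\<Sum>n\<in>A. q_fact q n * (cmod (a n))\<^sup>2))"
      unfolding ip_P_left[OF P_mem] tc_P[OF that]
      by (simp flip: complex_norm_square add: mult.assoc)
    then show ?thesis by simp
  qed
  \<comment> \<open>For the Taylor polynomial \<open>?P\<close>, both \<open>ip f ?P\<close> and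
    \<open>ip ?P ?P\<close> equal \<open>c * ?S\<close>, so the squared norm of
    \<open>f - ?P\<close> is that of \<open>f\<close> minus \<open>c * ?S\<close>.\<close>
  have bessel: "summable (\<lambda>n. q_fact q n * (cmod (taylor_coeff f n))\<^sup>2)" if f: "f \<in> H" for f
  proof (rule summableI_nonneg_bounded)
    show "0 \<le> q_fact q n * (cmod (taylor_coeff f n))\<^sup>2" for n
      using q_fact_pos[OF q(1), of n] by simp
    fix N
    let ?P = "P (taylor_coeff f) {..<N}"
    let ?S = "\<Sum>n<N. q_fact q n * (cmod (taylor_coeff f n))\<^sup>2"
    have "ip ?P f = of_real (c * ?S)"
      unfolding ip_P_left[OF f] by (simp flip: complex_norm_square add: mult.assoc)
    then have "ip f ?P = of_real (c * ?S)" using ip_cnj[OF P_mem f] by simp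
    moreover have "0 \<le> Re (ip (\<lambda>z. f z + (-1) * ?P z) (\<lambda>z. f z + (-1) * ?P z))"
      by (intro ip_nonneg add_mem scale_mem f P_mem)
    ultimately have "0 \<le> Re (ip f f) - c * ?S"
      unfolding hilb.sqn_add_scale[OF f P_mem] by (simp add: sqn_P)
    then show "?S \<le> Re (ip f f) / c" using c by (simp add: field_simps)
  qed
  \<comment> \<open>By orthogonality the polynomials \<open>P a {..<N}\<close> form a Cauchy
    sequence. Each coefficient is an inner product up to a nonzero factor, hence continuous, so the
    limit has coefficients \<open>a\<close>.\<close>
  have expansion: "\<exists>f\<in>H. (\<forall>n. taylor_coeff f n = a n) \<and>
      (\<lambda>N. Re (ip (\<lambda>z. P a {..<N} z - f z) (\<lambda>z. P a {..<N} z - f z))) \<longlonglongrightarrow> 0"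
    if a: "summable (\<lambda>n. q_fact q n * (cmod (a n))\<^sup>2)" for a
  proof -
    have diff: "Re (ip (\<lambda>z. P a {..<n} z - P a {..<m} z) (\<lambda>z. P a {..<n} z - P a {..<m} z))
        = c * (\<Sum>k\<in>{m..<n}. q_fact q k * (cmod (a k))\<^sup>2)" if "m \<le> n" for m n
    proof -
      have "(\<lambda>z. P a {..<n} z - P a {..<m} z) = P a {m..<n}"
        using that by (simp add: P_def fun_eq_iff lessThan_atLeast0 sum_diff_nat_ivl)
      then show ?thesis by (simp add: sqn_P)
    qed
    have "\<exists>f\<in>H. (\<lambda>N. Re (ip (\<lambda>z. P a {..<N} z - f z) (\<lambda>z. P a {..<N} z - f z))) \<longlonglongrightarrow> 0"
    proof (rule hilb.complete[OF P_mem])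
      fix e :: real assume "e > 0"
      then have "e / c > 0" using c by simp
      then obtain N where N: "\<And>m n. m \<ge> N \<Longrightarrow> norm (\<Sum>k\<in>{m..<n}. q_fact q k * (cmod (a k))\<^sup>2) < e / c"
        using a unfolding summable_Cauchy by blast
      have less: "Re (ip (\<lambda>z. P a {..<n} z - P a {..<m} z) (\<lambda>z. P a {..<n} z - P a {..<m} z)) < e"
        if "m \<le> n" "m \<ge> N" for m n
      proof -
        have "(\<Sum>k\<in>{m..<n}. q_fact q k * (cmod (a k))\<^sup>2) < e / c"
          using N[OF that(2), of n] by (simp add: abs_less_iff)
        then show ?thesis using c unfolding diff[OF that(1)] by (simp add: field_simps)
      qed
      have swap: "Re (ip (\<lambda>z. f z - g z) (\<lambda>z. f z - g z)) = Re (ip (\<lambda>z. g z - f z) (\<lambda>z. g z - f z))"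
        if "f \<in> H" "g \<in> H" for f g
        using that hilb.diff_mem by (simp add: hilb.ip_diff hilb.ip_diff_right)
      show "\<exists>N. \<forall>m\<ge>N. \<forall>n\<ge>N.
          Re (ip (\<lambda>z. P a {..<m} z - P a {..<n} z) (\<lambda>z. P a {..<m} z - P a {..<n} z)) < e"
      proof (intro exI[of _ N] allI impI)
        fix m n assume "m \<ge> N" "n \<ge> N"
        then show "Re (ip (\<lambda>z. P a {..<m} z - P a {..<n} z) (\<lambda>z. P a {..<m} z - P a {..<n} z)) < e"
          using less[of m n] less[of n m] swap[OF P_mem P_mem, of a "{..<m}" a "{..<n}"]
          by (cases "m \<le> n") auto
      qed
    qed
    then obtain f where f: "f \<in> H" and
      lim: "(\<lambda>N. Re (ip (\<lambda>z. P a {..<N} z - f z) (\<lambda>z. P a {..<N} z - f z))) \<longlonglongrightarrow> 0" by blast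
    have "taylor_coeff f n = a n" for n
    proof -
      have "(\<lambda>N. ip (P a {..<N}) (monom_fun n)) \<longlonglongrightarrow> ip f (monom_fun n)"
        by (rule hilb.ip_tendsto[OF P_mem f mem lim])
      moreover have "(\<lambda>N. ip (P a {..<N}) (monom_fun n)) \<longlonglongrightarrow> of_real (c * q_fact q n) * a n"
      proof (rule tendsto_eventually)
        show "\<forall>\<^sub>F N in sequentially. ip (P a {..<N}) (monom_fun n) = of_real (c * q_fact q n) * a n"
          using eventually_gt_at_top[of n] by eventually_elim (simp add: repr[OF P_mem] tc_P)
      qed
      ultimately have "ip f (monom_fun n) = of_real (c * q_fact q n) * a n" by (rule LIMSEQ_unique)
      then show ?thesis using c q_fact_pos[OF q(1), of n] by (simp add: repr[OF f])
    qed
    with f lim show ?thesis by blast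
  qed
  have inner: "ip f g = of_real c * H2q_inner q f g" if fg: "f \<in> H" "g \<in> H" for f g
  proof -
    obtain f' where f': "f' \<in> H" "\<And>n. taylor_coeff f' n = taylor_coeff f n" and
      lim: "(\<lambda>N. Re (ip (\<lambda>z. P (taylor_coeff f) {..<N} z - f' z)
                        (\<lambda>z. P (taylor_coeff f) {..<N} z - f' z))) \<longlonglongrightarrow> 0"
      using expansion[OF bessel[OF fg(1)]] by blast
    \<comment> \<open>The Taylor polynomials of \<open>f\<close> therefore converge to
      \<open>f\<close> in norm, and \<open>ip f g\<close> may be computed termwise.\<close>
    have "f' = f" by (rule eqI_taylor_coeff[OF f'(1) fg(1) f'(2)])
    then have "(\<lambda>N. ip (P (taylor_coeff f) {..<N}) g) \<longlonglongrightarrow> ip f g"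
      using hilb.ip_tendsto[OF P_mem f'(1) fg(2) lim] by simp
    moreover have "(\<lambda>N. ip (P (taylor_coeff f) {..<N}) g) \<longlonglongrightarrow> of_real c * H2q_inner q f g"
      unfolding ip_P_left[OF fg(2)] H2q_inner_def
      by (intro tendsto_intros summable_LIMSEQ summable_weighted_prod bessel fg q_fact_pos q)
    ultimately show ?thesis by (rule LIMSEQ_unique)
  qed
  show ?thesis
    unfolding equals_H2q_up_to_factor_def
  proof (intro conjI ballI)
    fix f assume f: "f \<in> H"
    from disc_fun_mem[OF q bessel[OF f]] show "\<exists>g\<in>H2q q. \<forall>\<^sub>F z in nhds 0. f z = g z"
      using eventually_eq_iff_taylor_coeff[OF analytic_0[OF f] H2q_analytic[OF q]]
        taylor_coeff_disc_fun[OF q bessel[OF f]] by metis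
  next
    fix g assume g: "g \<in> H2q q"
    then obtain f where "f \<in> H" "\<forall>n. taylor_coeff f n = taylor_coeff g n"
      using expansion[OF H2q_summable[OF q g]] by blast
    then show "\<exists>f\<in>H. \<forall>\<^sub>F z in nhds 0. f z = g z"
      using eventually_eq_iff_taylor_coeff[OF analytic_0 H2q_analytic[OF q g]] by blast
  qed (use c inner in blast)
qed

lemma monom_fun_holomorphic: "monom_fun n holomorphic_on \<Omega>"
proof -
  have "(\<lambda>z. z ^ n) holomorphic_on \<Omega>" by (intro holomorphic_intros)
  then show ?thesis by (rule holomorphic_transform) (simp add: monom_fun_def)
qed

text \<open>Describes the kernel of \<open>R\<^sub>q\<close>: the \<open>q\<close>-integers of
  positive index are nonzero, so \<open>R\<^sub>q p = 0\<close> kills all coefficients but the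
  first, and the identity theorem on \<open>\<Omega>\<close> applies.\<close>

lemma eq_const_monom_fun:
  assumes "p \<in> H" "\<And>n. taylor_coeff p (Suc n) = 0"
  shows "p = (\<lambda>z. p 0 * monom_fun 0 z)"
proof (rule eq_on_outsideI)
  show "(\<lambda>z. p 0 * monom_fun 0 z) holomorphic_on \<Omega>"
    by (intro holomorphic_intros monom_fun_holomorphic)
  have an: "monom_fun 0 analytic_on {0}"
    by (rule analytic_on_0I[OF monom_fun_holomorphic domain(1,3)])
  show "taylor_coeff p n = taylor_coeff (\<lambda>z. p 0 * monom_fun 0 z) n" for n
    using assms(2) by (cases n) (simp_all add: taylor_coeff_cmult[OF an] taylor_coeff_monom_fun
          taylor_coeff_at_0[of p])
qed (use assms analytic outside in \<open>auto simp: monom_fun_def\<close>)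

section \<open>Uniqueness when \<open>R\<^sub>q\<close> and \<open>M\<^sub>z\<close> are defined
  everywhere\<close>

lemma eq_zeroI: "f \<in> H \<Longrightarrow> Re (ip f f) = 0 \<Longrightarrow> f = (\<lambda>z. 0)"
  using ip_definite hilb.ip_self_of_real[of f] by simp

theorem equals_H2q_if_total:
  assumes q: "0 \<le> q" "q < 1" and nontrivial: "H \<noteq> {\<lambda>z. 0}"
    and dom_R: "Domain (Rq_graph q H) = H" and dom_M: "Domain (Mz_graph H) = H"
    and adjoint: "adjoint_graph H ip (Rq_graph q H) = Mz_graph H"
  shows "equals_H2q_up_to_factor q H ip"
proof -
  define M where "M f = (\<lambda>z::complex. z * f z :: complex)" for f
  have M_mem: "M f \<in> H" if "f \<in> H" for f
    using that dom_M by (auto simp: Mz_graph_def M_def)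
  have tc_M: "taylor_coeff (M f) 0 = 0" "taylor_coeff (M f) (Suc n) = taylor_coeff f n"
    if "f \<in> H" for f n
    unfolding M_def by (simp_all add: taylor_coeff_times_id[OF analytic_0[OF that]])
  have ex_R: "\<exists>f'. (f, f') \<in> Rq_graph q H" if "f \<in> H" for f
    using that dom_R by blast
  note R_iff = Rq_graph_iff[OF q(2)]
  have adj: "ip f' g = ip f (M g)" if "(f, f') \<in> Rq_graph q H" "g \<in> H" for f f' g
  proof -
    have "(g, M g) \<in> Mz_graph H" using that M_mem by (simp add: Mz_graph_def M_def)
    then show ?thesis using that(1) unfolding adjoint[symmetric] adjoint_graph_def by blast
  qed
  \<comment> \<open>This direction of the adjoint hypothesis makes \<open>M\<^sub>z\<close> a closed
    operator.\<close>
  have adj_M: "h = M g"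
    if "g \<in> H" "h \<in> H" "\<And>f f'. (f, f') \<in> Rq_graph q H \<Longrightarrow> ip f' g = ip f h" for g h
  proof -
    have "(g, h) \<in> Mz_graph H" using that unfolding adjoint[symmetric] adjoint_graph_def by blast
    then show ?thesis by (simp add: Mz_graph_def M_def)
  qed
  \<comment> \<open>\<open>R\<^sub>q M\<^sub>z = I + q M\<^sub>z R\<^sub>q\<close>, so \<open>\<parallel>M\<^sub>z f\<parallel>\<^sup>2 = \<parallel>f\<parallel>\<^sup>2 + q \<parallel>R\<^sub>q f\<parallel>\<^sup>2\<close>\<close>
  have expand: "Re (ip f f) \<le> Re (ip (M f) (M f))" if f: "f \<in> H" for f
  proof -
    obtain g where fg: "(f, g) \<in> Rq_graph q H" using ex_R[OF f] by blast
    then have g: "g \<in> H" by (simp add: R_iff)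
    have qMg: "(\<lambda>z. of_real q * M g z) \<in> H" by (intro scale_mem M_mem g)
    let ?u = "\<lambda>z. f z + of_real q * M g z"
    have "taylor_coeff ?u n = of_real (q_int q (Suc n)) * taylor_coeff f n" for n
      using fg by (cases n) (simp_all add: taylor_coeff_add[OF analytic_0[OF f] analytic_0[OF qMg]]
        taylor_coeff_cmult[OF analytic_0[OF M_mem[OF g]]] tc_M[OF g] R_iff q_int_Suc_left algebra_simps)
    then have "(M f, ?u) \<in> Rq_graph q H"
      using f M_mem[OF f] add_mem[OF f qMg] tc_M[OF f] by (simp add: R_iff)
    then have "ip (M f) (M f) = ip ?u f" using adj f by metis
    also have "\<dots> = ip f f + of_real q * ip (M g) f"
      using ip_add[OF f qMg f] ip_scale[OF M_mem[OF g] f] by simp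
    also have "ip (M g) f = cnj (ip g g)"
      using adj[OF fg g] ip_cnj[OF f M_mem[OF g]] by simp
    finally show ?thesis using q(1) ip_nonneg[OF g] by simp
  qed
  define Ran where "Ran = M ` H"
  have Ran_sub: "Ran \<subseteq> H" using M_mem by (auto simp: Ran_def)
  \<comment> \<open>The range of \<open>M\<^sub>z\<close> is complete: by \<open>expand\<close>,
    preimages of a Cauchy sequence are Cauchy, and closedness identifies the limit as an image. The
    Riesz theorem can then be used inside the range.\<close>
  interpret ran: hilbert_function_space Ran ip
  proof
    have "M (\<lambda>z. 0) = (\<lambda>z. 0)" by (simp add: M_def)
    then show "(\<lambda>z. 0) \<in> Ran" unfolding Ran_def using zero_mem by force
  next
    fix f g assume "f \<in> Ran" "g \<in> Ran"
    then obtain f' g' where f': "f' \<in> H" "g' \<in> H" "f = M f'" "g = M g'" by (auto simp: Ran_def)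
    then have "(\<lambda>z. f z + g z) = M (\<lambda>z. f' z + g' z)" by (simp add: M_def algebra_simps)
    then show "(\<lambda>z. f z + g z) \<in> Ran" unfolding Ran_def using add_mem[OF f'(1,2)] by blast
  next
    fix c f assume "f \<in> Ran"
    then obtain f' where f': "f' \<in> H" "f = M f'" by (auto simp: Ran_def)
    then have "(\<lambda>z. c * f z) = M (\<lambda>z. c * f' z)" by (simp add: M_def algebra_simps)
    then show "(\<lambda>z. c * f z) \<in> Ran" unfolding Ran_def using scale_mem[OF f'(1)] by blast
  next
    fix X :: "nat \<Rightarrow> complex \<Rightarrow> complex"
    assume X_Ran: "\<And>n. X n \<in> Ran"
      and cauchy: "\<And>e. e > 0 \<Longrightarrow> \<exists>N. \<forall>m\<ge>N. \<forall>n\<ge>N.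
        Re (ip (\<lambda>z. X m z - X n z) (\<lambda>z. X m z - X n z)) < e"
    have "\<exists>f. f \<in> H \<and> X n = M f" for n using X_Ran[of n] by (auto simp: Ran_def)
    then obtain F where F: "\<And>n. F n \<in> H" and XF: "\<And>n. X n = M (F n)" by metis
    have X: "X n \<in> H" for n unfolding XF by (rule M_mem[OF F])
    have le: "Re (ip (\<lambda>z. F m z - F n z) (\<lambda>z. F m z - F n z))
        \<le> Re (ip (\<lambda>z. X m z - X n z) (\<lambda>z. X m z - X n z))" for m n
    proof -
      have "(\<lambda>z. X m z - X n z) = M (\<lambda>z. F m z - F n z)"
        by (simp add: XF) (simp add: M_def algebra_simps)
      then show ?thesis using expand[OF hilb.diff_mem[OF F F]] by simp
    qed
    obtain f where f: "f \<in> H" and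
      limF: "(\<lambda>n. Re (ip (\<lambda>z. F n z - f z) (\<lambda>z. F n z - f z))) \<longlonglongrightarrow> 0"
      using hilb.complete[of F] F cauchy le by (meson le_less_trans)
    obtain h where h: "h \<in> H" and
      limX: "(\<lambda>n. Re (ip (\<lambda>z. X n z - h z) (\<lambda>z. X n z - h z))) \<longlonglongrightarrow> 0"
      using hilb.complete[of X] X cauchy by blast
    have "h = M f"
    proof (rule adj_M[OF f h])
      fix k k' assume kk': "(k, k') \<in> Rq_graph q H"
      then have k: "k \<in> H" "k' \<in> H" by (simp_all add: R_iff)
      have "(\<lambda>n. ip k' (F n)) \<longlonglongrightarrow> ip k' f" by (rule hilb.ip_tendsto_right[OF F f k(2) limF])
      moreover have "(\<lambda>n. ip k (X n)) \<longlonglongrightarrow> ip k h" by (rule hilb.ip_tendsto_right[OF X h k(1) limX])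
      moreover have "ip k' (F n) = ip k (X n)" for n unfolding XF by (rule adj[OF kk' F])
      ultimately show "ip k' f = ip k h" using LIMSEQ_unique by simp
    qed
    then have "h \<in> Ran" using f by (simp add: Ran_def)
    then show "\<exists>f\<in>Ran. (\<lambda>n. Re (ip (\<lambda>z. X n z - f z) (\<lambda>z. X n z - f z))) \<longlonglongrightarrow> 0"
      using limX by blast
  qed (use Ran_sub in \<open>blast intro: ip_add ip_scale ip_cnj ip_nonneg\<close>)+
  have split: "\<exists>p g. p \<in> H \<and> g \<in> H \<and> f = (\<lambda>z. p z + M g z) \<and> (\<forall>n. taylor_coeff p (Suc n) = 0)"
    if f: "f \<in> H" for f
  proof -
    \<comment> \<open>The representer of \<open>ip x f\<close> on the range is the orthogonal
      projection of \<open>f\<close>.\<close>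
    have "\<exists>m\<in>Ran. \<forall>x\<in>Ran. ip x f = ip x m"
    proof (rule ran.riesz_representation[of "\<lambda>x. ip x f" "sqrt (Re (ip f f))"])
      fix x assume "x \<in> Ran"
      then have "(cmod (ip x f))\<^sup>2 \<le> Re (ip x x) * Re (ip f f)"
        using hilb.cauchy_schwarz[OF _ f] Ran_sub by blast
      then show "cmod (ip x f) \<le> sqrt (Re (ip f f)) * sqrt (Re (ip x x))"
        by (simp add: real_le_rsqrt mult.commute flip: real_sqrt_mult)
    next
      show "ip (\<lambda>z. x z + y z) f = ip x f + ip y f" if "x \<in> Ran" "y \<in> Ran" for x y
        by (rule ip_add) (use that f Ran_sub in auto)
      show "ip (\<lambda>z. a * x z) f = a * ip x f" if "x \<in> Ran" for a x
        by (rule ip_scale) (use that f Ran_sub in auto)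
    qed blast
    then obtain m where m: "m \<in> Ran" and m_eq: "\<And>x. x \<in> Ran \<Longrightarrow> ip x f = ip x m"
      by blast
    then obtain g where g: "g \<in> H" "m = M g" by (auto simp: Ran_def)
    let ?p = "\<lambda>z. f z - M g z"
    have p: "?p \<in> H" by (intro hilb.diff_mem f M_mem g)
    obtain p' where pp': "(?p, p') \<in> Rq_graph q H" using ex_R[OF p] by blast
    then have p': "p' \<in> H" by (simp add: R_iff)
    \<comment> \<open>The remainder \<open>?p\<close> is orthogonal to the range, in particular to
      \<open>M p'\<close> with \<open>p'\<close> its own image under \<open>R\<^sub>q\<close>; the
      adjoint relation turns this into \<open>ip p' p' = 0\<close>.\<close>
    have "ip (M p') ?p = 0"
      using m_eq[of "M p'"] hilb.ip_diff_right[OF f M_mem[OF g(1)] M_mem[OF p']] p'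
      by (simp add: Ran_def g(2))
    then have "ip p' p' = 0" using adj[OF pp' p'] ip_cnj[OF M_mem[OF p'] p] by simp
    then have "p' = (\<lambda>z. 0)" by (rule ip_definite[OF p'])
    then have "taylor_coeff ?p (Suc n) = 0" for n
      using pp' q_int_ge_1[OF q(1), of n] unfolding R_iff
      by (metis mult_eq_0_iff not_one_le_zero of_real_eq_0_iff taylor_coeff_zero_fun)
    moreover have "f = (\<lambda>z. ?p z + M g z)" by simp
    ultimately show ?thesis using p g(1) by blast
  qed
  have one: "monom_fun 0 \<in> H"
  proof (rule ccontr)
    assume no: "monom_fun 0 \<notin> H"
    \<comment> \<open>A nonzero constant summand in \<open>split\<close> could be rescaled to
      \<open>monom_fun 0\<close>, so only the multiple of \<open>z\<close> remains.\<close>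
    have div: "\<exists>g\<in>H. f = M g" if f: "f \<in> H" for f
    proof -
      obtain p g where pg: "p \<in> H" "g \<in> H" "f = (\<lambda>z. p z + M g z)" "\<And>n. taylor_coeff p (Suc n) = 0"
        using split[OF f] by blast
      note p_eq = eq_const_monom_fun[OF pg(1,4)]
      have "p 0 = 0"
      proof (rule ccontr)
        assume "p 0 \<noteq> 0"
        then have "(\<lambda>z. inverse (p 0) * p z) = monom_fun 0"
          by (subst p_eq) (simp add: fun_eq_iff)
        then show False using no scale_mem[OF pg(1), of "inverse (p 0)"] by simp
      qed
      then have "p = (\<lambda>z. 0)" using p_eq by simp
      then show ?thesis using pg(2,3) by auto
    qed
    have "taylor_coeff f n = 0" if "f \<in> H" for f n
      using that
    proof (induction n arbitrary: f)
      case 0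
      then show ?case using div tc_M(1) by metis
    next
      case (Suc n)
      then show ?case using div tc_M(2) by metis
    qed
    then have "f = (\<lambda>z. 0)" if "f \<in> H" for f
      by (intro eqI_taylor_coeff[OF that zero_mem]) (simp add: that)
    then show False using nontrivial zero_mem by blast
  qed
  have mem: "monom_fun n \<in> H" for n
  proof (induction n)
    case (Suc n)
    have "monom_fun (Suc n) = M (monom_fun n)" by (simp add: fun_eq_iff M_def monom_fun_def)
    then show ?case using M_mem[OF Suc] by simp
  qed (rule one)
  define c where "c = Re (ip (monom_fun 0) (monom_fun 0))"
  have c_eq: "ip (monom_fun 0) (monom_fun 0) = of_real c"
    unfolding c_def by (rule hilb.ip_self_of_real[OF one])
  have "monom_fun 0 \<noteq> (\<lambda>z. 0)" using taylor_coeff_monom_fun[of 0 0] by auto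
  then have "c \<noteq> 0" using eq_zeroI[OF one] by (auto simp: c_def)
  then have c: "c > 0" using ip_nonneg[OF one] by (simp add: c_def)
  have repr0: "ip f (monom_fun 0) = of_real c * f 0" if f: "f \<in> H" for f
  proof -
    obtain p g where pg: "p \<in> H" "g \<in> H" "f = (\<lambda>z. p z + M g z)" "\<And>n. taylor_coeff p (Suc n) = 0"
      using split[OF f] by blast
    \<comment> \<open>\<open>R\<^sub>q\<close> annihilates constants, so the range of
      \<open>M\<^sub>z\<close> is orthogonal to them and only the constant part of \<open>f\<close>
      contributes.\<close>
    have "(monom_fun 0, \<lambda>z. 0) \<in> Rq_graph q H"
      using one zero_mem by (simp add: R_iff taylor_coeff_monom_fun)
    from adj[OF this pg(2)] have "ip (M g) (monom_fun 0) = 0"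
      using ip_cnj[OF one M_mem[OF pg(2)]] hilb.ip_zero_left[OF pg(2)] by simp
    moreover have "ip p (monom_fun 0) = p 0 * of_real c"
      using arg_cong[OF eq_const_monom_fun[OF pg(1,4)], of "\<lambda>x. ip x (monom_fun 0)"]
      unfolding ip_scale[OF one one] c_eq .
    moreover have "p 0 = f 0" by (simp add: pg(3) M_def)
    moreover have "ip f (monom_fun 0) = ip p (monom_fun 0) + ip (M g) (monom_fun 0)"
      unfolding pg(3) by (rule ip_add[OF pg(1) M_mem[OF pg(2)] one])
    ultimately show ?thesis by simp
  qed
  have "ip f (monom_fun n) = of_real (c * q_fact q n) * taylor_coeff f n" if "f \<in> H" for f n
    using that
  proof (induction n arbitrary: f)
    case 0
    then show ?case by (simp add: repr0 taylor_coeff_at_0)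
  next
    case (Suc n)
    obtain f' where ff': "(f, f') \<in> Rq_graph q H" using ex_R[OF Suc.prems] by blast
    have "monom_fun (Suc n) = M (monom_fun n)" by (simp add: fun_eq_iff M_def monom_fun_def)
    \<comment> \<open>One factor \<open>z\<close> is traded for one application of
      \<open>R\<^sub>q\<close>, which contributes the factor \<open>q_int q (Suc n)\<close>.\<close>
    then have "ip f (monom_fun (Suc n)) = ip f' (monom_fun n)" using adj[OF ff' mem] by simp
    also have "\<dots> = of_real (c * q_fact q n) * taylor_coeff f' n"
      using ff' Suc.IH by (simp add: R_iff)
    also have "taylor_coeff f' n = of_real (q_int q (Suc n)) * taylor_coeff f (Suc n)"
      using ff' by (simp add: R_iff)
    finally show ?case by (simp add: q_fact_Suc)
  qed
  from equals_H2q_if_taylor_coeff_represented[OF q c mem this] show ?thesis .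
qed

section \<open>Uniqueness when point evaluations are bounded\<close>

text \<open>A pair \<open>(f, g)\<close> in \<open>H \<oplus> H\<close> is encoded as the function \<open>case_sum f g\<close> on the disjoint sum.\<close>

lemma Rq_graph_hilbert_function_space:
  assumes q: "0 \<le> q" "q < 1" and bdd: "bounded_evaluations \<Omega> H ip"
  shows "hilbert_function_space
    {F :: complex + complex \<Rightarrow> complex. (\<lambda>z. F (Inl z), \<lambda>z. F (Inr z)) \<in> Rq_graph q H}
    (\<lambda>F G. ip (\<lambda>z. F (Inl z)) (\<lambda>z. G (Inl z)) + ip (\<lambda>z. F (Inr z)) (\<lambda>z. G (Inr z)))"
    (is "hilbert_function_space ?G ?ip")
proof
  note R_iff = Rq_graph_iff[OF q(2)]
  show "(\<lambda>z. 0) \<in> ?G" using zero_mem by (simp add: R_iff)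
  show "(\<lambda>z. F z + G z) \<in> ?G" if "F \<in> ?G" "G \<in> ?G" for F G
    using that by (simp add: R_iff add_mem taylor_coeff_add analytic_0 distrib_left)
  show "(\<lambda>z. c * F z) \<in> ?G" if "F \<in> ?G" for c F
    using that by (simp add: R_iff scale_mem taylor_coeff_cmult analytic_0)
  show "?ip (\<lambda>z. F z + G z) K = ?ip F K + ?ip G K" if "F \<in> ?G" "G \<in> ?G" "K \<in> ?G" for F G K
    using that by (simp add: R_iff ip_add)
  show "?ip (\<lambda>z. c * F z) K = c * ?ip F K" if "F \<in> ?G" "K \<in> ?G" for c F K
    using that by (simp add: R_iff ip_scale distrib_left)
  show "?ip G F = cnj (?ip F G)" if "F \<in> ?G" "G \<in> ?G" for F G
    using that ip_cnj[of "\<lambda>z. F (Inl z)" "\<lambda>z. G (Inl z)"] ip_cnj[of "\<lambda>z. F (Inr z)" "\<lambda>z. G (Inr z)"]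
    by (simp add: R_iff)
  show "0 \<le> Re (?ip F F)" if "F \<in> ?G" for F
    using that by (simp add: R_iff ip_nonneg)
  fix X :: "nat \<Rightarrow> complex + complex \<Rightarrow> complex"
  assume X: "\<And>n. X n \<in> ?G"
    and cauchy: "\<And>e. e > 0 \<Longrightarrow> \<exists>N. \<forall>m\<ge>N. \<forall>n\<ge>N.
      Re (?ip (\<lambda>z. X m z - X n z) (\<lambda>z. X m z - X n z)) < e"
  define f g where "f n z = X n (Inl z)" and "g n z = X n (Inr z)" for n z
  have fg: "(f n, g n) \<in> Rq_graph q H" for n
    using X[of n] by (simp add: f_def[abs_def] g_def[abs_def])
  then have f: "f n \<in> H" and g: "g n \<in> H" for n by (simp_all add: R_iff)
  have le: "Re (ip (\<lambda>z. f m z - f n z) (\<lambda>z. f m z - f n z))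
        \<le> Re (?ip (\<lambda>z. X m z - X n z) (\<lambda>z. X m z - X n z))"
      "Re (ip (\<lambda>z. g m z - g n z) (\<lambda>z. g m z - g n z))
        \<le> Re (?ip (\<lambda>z. X m z - X n z) (\<lambda>z. X m z - X n z))" for m n
    using ip_nonneg[OF hilb.diff_mem[OF f f], of m n] ip_nonneg[OF hilb.diff_mem[OF g g], of m n]
    by (simp_all add: f_def g_def)
  obtain f0 where f0: "f0 \<in> H" and
    limf: "(\<lambda>n. Re (ip (\<lambda>z. f n z - f0 z) (\<lambda>z. f n z - f0 z))) \<longlonglongrightarrow> 0"
    using hilb.complete[of f] f cauchy le(1) by (meson le_less_trans)
  obtain g0 where g0: "g0 \<in> H" and
    limg: "(\<lambda>n. Re (ip (\<lambda>z. g n z - g0 z) (\<lambda>z. g n z - g0 z))) \<longlonglongrightarrow> 0"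
    using hilb.complete[of g] g cauchy le(2) by (meson le_less_trans)
  \<comment> \<open>Bounded evaluations turn norm convergence into pointwise convergence, so the
    equation defining \<open>R\<^sub>q\<close> passes to the limit.\<close>
  have pointwise: "(\<lambda>n. h n w) \<longlonglongrightarrow> h0 w"
    if h: "\<And>n. h n \<in> H" "h0 \<in> H" and w: "w \<in> \<Omega>"
      and lim: "(\<lambda>n. Re (ip (\<lambda>z. h n z - h0 z) (\<lambda>z. h n z - h0 z))) \<longlonglongrightarrow> 0" for h h0 w
  proof -
    obtain C where C: "\<And>f. f \<in> H \<Longrightarrow> cmod (f w) \<le> C * ip_norm ip f"
      using bdd w unfolding bounded_evaluations_def by blast
    have "(\<lambda>n. C * ip_norm ip (\<lambda>z. h n z - h0 z)) \<longlonglongrightarrow> C * sqrt 0"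
      unfolding ip_norm_def by (intro tendsto_intros lim)
    then have lim0: "(\<lambda>n. C * ip_norm ip (\<lambda>z. h n z - h0 z)) \<longlonglongrightarrow> 0" by simp
    have "(\<lambda>n. h n w - h0 w) \<longlonglongrightarrow> 0"
      by (rule Lim_null_comparison[OF always_eventually lim0]) (use C[OF hilb.diff_mem[OF h]] in blast)
    then show ?thesis by (simp add: LIM_zero_iff)
  qed
  \<comment> \<open>\<open>\<Omega>\<close> need not be invariant under multiplication by
    \<open>q\<close>, but a disc around 0 is.\<close>
  obtain r where r: "r > 0" "ball 0 r \<subseteq> \<Omega>"
    using domain(1,3) open_contains_ball by blast
  have hol: "h holomorphic_on ball 0 r" if "h \<in> H" for h
    using holomorphic_on_subset[OF analytic[OF that] r(2)] .
  note ball_iff = Rq_iff_ball[OF hol hol q r(1)]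
  have "(1 - of_real q) * (z * g0 z) = f0 z - f0 (of_real q * z)" if z: "z \<in> ball 0 r" for z
  proof (rule LIMSEQ_unique)
    have "q * cmod z \<le> cmod z" using q by (simp add: mult_left_le_one_le)
    then have "of_real q * z \<in> ball 0 r" using z q by (simp add: norm_mult)
    then have in_dom: "z \<in> \<Omega>" "of_real q * z \<in> \<Omega>" using z r(2) by auto
    show "(\<lambda>n. (1 - of_real q) * (z * g n z)) \<longlonglongrightarrow> (1 - of_real q) * (z * g0 z)"
      by (intro tendsto_intros pointwise[OF g g0 in_dom(1) limg])
    have "(1 - of_real q) * (z * g n z) = f n z - f n (of_real q * z)" for n
      using fg[of n] ball_iff[OF f g, of n n] z unfolding Rq_graph_def by blast
    then show "(\<lambda>n. (1 - of_real q) * (z * g n z)) \<longlonglongrightarrow> f0 z - f0 (of_real q * z)"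
      using tendsto_diff[OF pointwise[OF f f0 in_dom(1) limf] pointwise[OF f f0 in_dom(2) limf]]
      by simp
  qed
  then have "(f0, g0) \<in> Rq_graph q H"
    using ball_iff[OF f0 g0] f0 g0 unfolding Rq_graph_def by blast
  then have mem: "case_sum f0 g0 \<in> ?G" by simp
  have "(\<lambda>n. Re (?ip (\<lambda>z. X n z - case_sum f0 g0 z) (\<lambda>z. X n z - case_sum f0 g0 z))) \<longlonglongrightarrow> 0"
    using tendsto_add[OF limf limg] by (simp add: f_def g_def)
  with mem show "\<exists>F\<in>?G. (\<lambda>n. Re (?ip (\<lambda>z. X n z - F z) (\<lambda>z. X n z - F z))) \<longlonglongrightarrow> 0" by blast
qed

text \<open>\<open>R\<^sub>q\<close> is closed, hence equal to \<open>M\<^sub>z\<^sup>*\<close>, and kernel functions are eigenvectors of \<open>M\<^sub>z\<^sup>*\<close>.\<close>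

lemma Rq_kernel_function:
  assumes q: "0 \<le> q" "q < 1" and bdd: "bounded_evaluations \<Omega> H ip"
    and adjoint: "adjoint_graph H ip (Rq_graph q H) = Mz_graph H"
    and k: "k \<in> H" "\<And>f. f \<in> H \<Longrightarrow> f w = ip f k"
  shows "(k, \<lambda>z. cnj w * k z) \<in> Rq_graph q H"
proof -
  note R_iff = Rq_graph_iff[OF q(2)]
  let ?G = "{F :: complex + complex \<Rightarrow> complex. (\<lambda>z. F (Inl z), \<lambda>z. F (Inr z)) \<in> Rq_graph q H}"
  let ?k = "\<lambda>z. cnj w * k z"
  have k': "?k \<in> H" by (rule scale_mem[OF k(1)])
  interpret gr: hilbert_function_space ?G
      "\<lambda>F G. ip (\<lambda>z. F (Inl z)) (\<lambda>z. G (Inl z)) + ip (\<lambda>z. F (Inr z)) (\<lambda>z. G (Inr z))"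
    by (rule Rq_graph_hilbert_function_space[OF q bdd])
  \<comment> \<open>\<open>P\<close> encodes the orthogonal projection of the pair
    \<open>(k, ?k)\<close> onto the graph of \<open>R\<^sub>q\<close>; the aim is to show that the
    pair equals its projection.\<close>
  have "\<exists>P\<in>?G. \<forall>F\<in>?G.
      ip (\<lambda>z. F (Inl z)) k + ip (\<lambda>z. F (Inr z)) ?k =
      ip (\<lambda>z. F (Inl z)) (\<lambda>z. P (Inl z)) + ip (\<lambda>z. F (Inr z)) (\<lambda>z. P (Inr z))"
  proof (rule gr.riesz_representation[of "\<lambda>F. ip (\<lambda>z. F (Inl z)) k + ip (\<lambda>z. F (Inr z)) ?k"
        "sqrt (Re (ip k k)) + sqrt (Re (ip ?k ?k))"])
    fix F assume "F \<in> ?G"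
    then have F: "(\<lambda>z. F (Inl z)) \<in> H" "(\<lambda>z. F (Inr z)) \<in> H" by (simp_all add: R_iff)
    let ?n = "Re (ip (\<lambda>z. F (Inl z)) (\<lambda>z. F (Inl z)) + ip (\<lambda>z. F (Inr z)) (\<lambda>z. F (Inr z)))"
    have bound: "cmod (ip f h) \<le> sqrt (Re (ip h h)) * sqrt ?n"
      if "f \<in> H" "h \<in> H" "Re (ip f f) \<le> ?n" for f h
    proof -
      have "(cmod (ip f h))\<^sup>2 \<le> Re (ip h h) * ?n"
        using hilb.cauchy_schwarz[OF that(1,2)] mult_left_mono[OF that(3) ip_nonneg[OF that(2)]]
        by (simp add: mult.commute)
      then show ?thesis unfolding real_sqrt_mult[symmetric] by (rule real_le_rsqrt)
    qed
    have "cmod (ip (\<lambda>z. F (Inl z)) k) \<le> sqrt (Re (ip k k)) * sqrt ?n"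
      by (rule bound[OF F(1) k(1)]) (use ip_nonneg[OF F(2)] in simp)
    moreover have "cmod (ip (\<lambda>z. F (Inr z)) ?k) \<le> sqrt (Re (ip ?k ?k)) * sqrt ?n"
      by (rule bound[OF F(2) k']) (use ip_nonneg[OF F(1)] in simp)
    ultimately show "cmod (ip (\<lambda>z. F (Inl z)) k + ip (\<lambda>z. F (Inr z)) ?k)
        \<le> (sqrt (Re (ip k k)) + sqrt (Re (ip ?k ?k))) * sqrt ?n"
      unfolding distrib_right by (intro order.trans[OF norm_triangle_ineq] add_mono)
  next
    show "ip (\<lambda>z. F (Inl z) + G (Inl z)) k + ip (\<lambda>z. F (Inr z) + G (Inr z)) ?k =
        (ip (\<lambda>z. F (Inl z)) k + ip (\<lambda>z. F (Inr z)) ?k) +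
        (ip (\<lambda>z. G (Inl z)) k + ip (\<lambda>z. G (Inr z)) ?k)" if "F \<in> ?G" "G \<in> ?G" for F G
      using that by (simp add: R_iff ip_add[OF _ _ k(1)] ip_add[OF _ _ k'])
    show "ip (\<lambda>z. c * F (Inl z)) k + ip (\<lambda>z. c * F (Inr z)) ?k =
        c * (ip (\<lambda>z. F (Inl z)) k + ip (\<lambda>z. F (Inr z)) ?k)" if "F \<in> ?G" for c F
      using that by (simp add: R_iff ip_scale[OF _ k(1)] ip_scale[OF _ k'] distrib_left)
  qed blast
  then obtain P where P: "P \<in> ?G" and P_eq: "\<And>F. F \<in> ?G \<Longrightarrow>
      ip (\<lambda>z. F (Inl z)) k + ip (\<lambda>z. F (Inr z)) ?k =
      ip (\<lambda>z. F (Inl z)) (\<lambda>z. P (Inl z)) + ip (\<lambda>z. F (Inr z)) (\<lambda>z. P (Inr z))"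
    by blast
  define p p' where "p z = P (Inl z)" and "p' z = P (Inr z)" for z
  have pR: "(p, p') \<in> Rq_graph q H"
    using P by (simp add: p_def[abs_def] p'_def[abs_def])
  then have p: "p \<in> H" "p' \<in> H" by (simp_all add: R_iff)
  define u v where "u z = k z - p z" and "v z = cnj w * k z - p' z" for z
  have u: "u \<in> H" unfolding u_def by (rule hilb.diff_mem[OF k(1) p(1)])
  have v: "v \<in> H" unfolding v_def by (rule hilb.diff_mem[OF k' p(2)])
  have orth: "ip f u + ip f' v = 0" if "(f, f') \<in> Rq_graph q H" for f f'
  proof -
    have ff': "f \<in> H" "f' \<in> H" using that by (simp_all add: R_iff)
    have "ip f k + ip f' ?k = ip f p + ip f' p'"
      using P_eq[of "case_sum f f'"] that by (simp add: p_def[abs_def] p'_def[abs_def])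
    moreover have "ip f u = ip f k - ip f p"
      unfolding u_def[abs_def] by (rule hilb.ip_diff_right[OF k(1) p(1) ff'(1)])
    moreover have "ip f' v = ip f' ?k - ip f' p'"
      unfolding v_def[abs_def] by (rule hilb.ip_diff_right[OF k' p(2) ff'(2)])
    ultimately show ?thesis using add_diff_add[of "ip f k" "ip f' ?k" "ip f p" "ip f' p'"] by simp
  qed
  \<comment> \<open>Orthogonality of \<open>(u, v)\<close> to the graph of \<open>R\<^sub>q\<close>
    means that \<open>(v, - u)\<close> lies in the graph of the adjoint, that is, of
    \<open>M\<^sub>z\<close>. So \<open>- u = z v\<close>, which is evaluated at
    \<open>w\<close>.\<close>
  let ?u = "\<lambda>z. (-1) * u z"
  have u': "?u \<in> H" by (rule scale_mem[OF u])
  have "ip f' v = ip f ?u" if "(f, f') \<in> Rq_graph q H" for f f'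
    using orth[OF that] hilb.ip_scale_right[OF u, of f "-1"] that
    by (simp add: R_iff add_eq_0_iff2)
  then have "(v, ?u) \<in> adjoint_graph H ip (Rq_graph q H)"
    using u' v unfolding adjoint_graph_def by blast
  then have "?u = (\<lambda>z. z * v z)" unfolding adjoint Mz_graph_def by simp
  from fun_cong[OF this, of w] have "w * v w = - u w" by simp
  then have uv: "u w + w * v w = 0" by simp
  \<comment> \<open>The projection is orthogonal to \<open>(u, v)\<close>, so the squared norm of
    \<open>(u, v)\<close> is its pairing with \<open>(k, ?k)\<close>, which the kernel property
    reduces to values at \<open>w\<close>.\<close>
  have "ip u u + ip v v = ip k u + ip ?k v - (ip p u + ip p' v)"
    using hilb.ip_diff[OF k(1) p(1) u] hilb.ip_diff[OF k' p(2) v]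
    by (simp add: u_def[abs_def] v_def[abs_def])
  also have "\<dots> = cnj (u w) + cnj w * cnj (v w)"
    using orth[OF pR] ip_cnj[OF u k(1)] ip_cnj[OF v k(1)] k(2)[OF u] k(2)[OF v] ip_scale[OF k(1) v]
    by simp
  also have "\<dots> = cnj (u w + w * v w)" by simp
  finally have "Re (ip u u) + Re (ip v v) = 0" using uv by (simp flip: plus_complex.sel)
  then have "Re (ip u u) = 0" "Re (ip v v) = 0" using ip_nonneg[OF u] ip_nonneg[OF v] by linarith+
  then have "u = (\<lambda>z. 0)" "v = (\<lambda>z. 0)" using eq_zeroI u v by auto
  then have "p = k" "p' = ?k" by (auto simp: u_def v_def fun_eq_iff)
  with pR show ?thesis by simp
qed

theorem equals_H2q_if_bounded_evaluations:
  assumes q: "0 \<le> q" "q < 1" and nontrivial: "H \<noteq> {\<lambda>z. 0}"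
    and bdd: "bounded_evaluations \<Omega> H ip"
    and adjoint: "adjoint_graph H ip (Rq_graph q H) = Mz_graph H"
  shows "equals_H2q_up_to_factor q H ip"
proof -
  have "\<forall>w\<in>\<Omega>. \<exists>k. k \<in> H \<and> (\<forall>f\<in>H. f w = ip f k)"
  proof
    fix w assume "w \<in> \<Omega>"
    with bdd have "\<exists>C. \<forall>f\<in>H. cmod (f w) \<le> C * ip_norm ip f"
      unfolding bounded_evaluations_def by (rule bspec)
    then obtain C where C: "\<forall>f\<in>H. cmod (f w) \<le> C * ip_norm ip f" ..
    obtain k where "k \<in> H" and k: "\<And>f. f \<in> H \<Longrightarrow> f w = ip f k"
    proof (rule hilb.riesz_representation[where L = "\<lambda>f. f w" and C = C])
      show "cmod (f w) \<le> C * sqrt (Re (ip f f))" if "f \<in> H" for f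
        using bspec[OF C that] unfolding ip_norm_def .
      fix p assume p: "p \<in> H" "\<And>f. f \<in> H \<Longrightarrow> f w = ip f p"
      show thesis by (rule that[OF p])
    qed (rule refl)+
    then show "\<exists>k. k \<in> H \<and> (\<forall>f\<in>H. f w = ip f k)" by (intro exI[of _ k] conjI ballI k)
  qed
  from bchoice[OF this] obtain K where K_all: "\<forall>w\<in>\<Omega>. K w \<in> H \<and> (\<forall>f\<in>H. f w = ip f (K w))" ..
  have K: "K w \<in> H" if "w \<in> \<Omega>" for w
    using K_all that by blast
  have K_repr: "f w = ip f (K w)" if "w \<in> \<Omega>" "f \<in> H" for w f
    using bspec[OF conjunct2[OF bspec[OF K_all that(1)]] that(2)] .
  have eigen: "of_real (q_int q (Suc n)) * taylor_coeff (K w) (Suc n) = cnj w * taylor_coeff (K w) n"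
    if w: "w \<in> \<Omega>" for w n
    using Rq_kernel_function[OF q bdd adjoint K[OF w] K_repr[OF w]]
    by (simp add: Rq_graph_iff[OF q(2)] taylor_coeff_cmult[OF analytic_0[OF K[OF w]]])
  have tc_K0: "taylor_coeff (K w) n = K w 0 * cnj w ^ n / of_real (q_fact q n)" if w: "w \<in> \<Omega>" for w n
  proof (induction n)
    case 0
    then show ?case by (simp add: taylor_coeff_at_0)
  next
    case (Suc n)
    have "q_int q (Suc n) \<noteq> 0" "q_fact q n \<noteq> 0"
      using q_int_ge_1[OF q(1), of n] q_fact_pos[OF q(1), of n] by auto
    then show ?case using eigen[OF w, of n] unfolding Suc q_fact_Suc
      by (simp add: field_simps)
  qed
  have zero: "0 \<in> \<Omega>" by (rule domain(3))
  \<comment> \<open>The kernel function at 0 has eigenvalue 0, hence is the constant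
    \<open>c\<close>. Symmetry of the kernel then gives \<open>K w 0 = c\<close> for every
    \<open>w\<close>, which fixes the free factor in \<open>tc_K0\<close>.\<close>
  define c where "c = Re (ip (K 0) (K 0))"
  have K00: "K 0 0 = of_real c"
    using K_repr[OF zero K[OF zero]] hilb.ip_self_of_real[OF K[OF zero]] by (simp add: c_def)
  have "taylor_coeff (K 0) (Suc n) = 0" for n using tc_K0[OF zero, of "Suc n"] by simp
  note K0_eq = eq_const_monom_fun[OF K[OF zero] this]
  have K0: "K 0 z = of_real c" if "z \<in> \<Omega>" for z
    using fun_cong[OF K0_eq, of z] that K00 by (simp add: monom_fun_def)
  have Kw0: "K w 0 = of_real c" if w: "w \<in> \<Omega>" for w
  proof -
    have "K w 0 = ip (K w) (K 0)" by (rule K_repr[OF zero K[OF w]])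
    also have "\<dots> = cnj (ip (K 0) (K w))" by (rule ip_cnj[OF K[OF zero] K[OF w]])
    also have "ip (K 0) (K w) = K 0 w" by (rule K_repr[OF w K[OF zero], symmetric])
    finally show ?thesis using K0[OF w] by simp
  qed
  have tc_K: "taylor_coeff (K w) n = of_real c * cnj w ^ n / of_real (q_fact q n)" if "w \<in> \<Omega>" for w n
    using tc_K0[OF that] Kw0[OF that] by simp
  have "c \<noteq> 0"
  proof
    assume "c = 0"
    then have "K w = (\<lambda>z. 0)" if "w \<in> \<Omega>" for w
      by (intro eqI_taylor_coeff[OF K[OF that] zero_mem]) (simp add: tc_K[OF that])
    then have "f w = 0" if "f \<in> H" for f w
      using that K_repr[of w f] outside[of f w] hilb.ip_zero_right[of f] by (cases "w \<in> \<Omega>") auto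
    then have "f = (\<lambda>z. 0)" if "f \<in> H" for f using that by blast
    then show False using nontrivial zero_mem by blast
  qed
  then have c: "c > 0" using ip_nonneg[OF K[OF zero]] by (simp add: c_def)
  obtain r where r: "r > 0" "cball 0 r \<subseteq> \<Omega>"
    using domain(1,3) open_contains_cball by blast
  \<comment> \<open>The Taylor series of \<open>K w\<close> at \<open>w\<close> has terms depending
    only on \<open>cmod w\<close>. Hence the kernel functions have constant norm on small circles,
    as needed for Cauchy's inequality.\<close>
  have K_diag: "K w w = K (of_real (cmod w)) (of_real (cmod w))" if w: "cmod w < r" for w
  proof -
    have sums: "(\<lambda>n. of_real (c * ((cmod v)\<^sup>2) ^ n / q_fact q n)) sums K v v" if v: "cmod v < r" for v
    proof -
      have v\<Omega>: "v \<in> \<Omega>" using v r(2) by auto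
      have "K v holomorphic_on ball 0 r"
        by (rule holomorphic_on_subset[OF analytic[OF K[OF v\<Omega>]]]) (use r(2) ball_subset_cball in blast)
      from taylor_coeff_sums[OF this v]
      have "(\<lambda>n. of_real c * cnj v ^ n / of_real (q_fact q n) * v ^ n) sums K v v"
        by (simp add: tc_K[OF v\<Omega>])
      moreover have "of_real c * cnj v ^ n / of_real (q_fact q n) * v ^ n
          = of_real (c * ((cmod v)\<^sup>2) ^ n / q_fact q n)" for n
        using complex_norm_square[of v] by (simp add: power_mult_distrib[symmetric] mult.commute)
      ultimately show ?thesis by (simp only:)
    qed
    show ?thesis using sums_unique2[OF sums[OF w]] sums[of "of_real (cmod w)"] w by simp
  qed
  have "\<exists>u. u \<in> H \<and> (\<forall>f\<in>H. taylor_coeff f n = ip f u)" for n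
  proof -
    define s where "s = r / 2"
    have s: "0 < s" "s < r" using r(1) by (simp_all add: s_def)
    \<comment> \<open>\<open>B\<close> is the common norm of the kernel functions on the circle of
      radius \<open>s\<close>; it bounds point evaluations there.\<close>
    define B where "B = sqrt (Re (K (of_real s) (of_real s)))"
    have bound: "cmod (taylor_coeff f n) \<le> B / s ^ n * sqrt (Re (ip f f))" if f: "f \<in> H" for f
    proof -
      have sub: "cball 0 s \<subseteq> \<Omega>" using r(2) s(2) by (meson cball_subset_cball_iff order.trans less_imp_le subset_cball)
      have "cmod (f w) \<le> B * sqrt (Re (ip f f))" if "cmod (0 - w) = s" for w
      proof -
        have w: "cmod w = s" "w \<in> \<Omega>" using that sub by auto
        have "ip (K w) (K w) = K (of_real s) (of_real s)"
          using K_diag[of w] K_repr[OF w(2) K[OF w(2)]] w(1) s(2) by simp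
        then have "(cmod (f w))\<^sup>2 \<le> Re (ip f f) * Re (K (of_real s) (of_real s))"
          using hilb.cauchy_schwarz[OF f K[OF w(2)]] K_repr[OF w(2) f] by simp
        then show ?thesis unfolding B_def real_sqrt_mult[symmetric]
          by (intro real_le_rsqrt) (simp add: mult.commute)
      qed
      moreover have "f holomorphic_on ball 0 s" "continuous_on (cball 0 s) f"
        using holomorphic_on_subset[OF analytic[OF f]] sub ball_subset_cball[of 0 s]
          holomorphic_on_imp_continuous_on by blast+
      ultimately have "cmod ((deriv ^^ n) f 0) \<le> fact n * (B * sqrt (Re (ip f f))) / s ^ n"
        using s(1) by (intro Cauchy_inequality)
      then show ?thesis by (simp add: taylor_coeff_def norm_divide divide_le_eq mult_ac)
    qed
    obtain u where "u \<in> H" and u: "\<And>f. f \<in> H \<Longrightarrow> taylor_coeff f n = ip f u"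
    proof (rule hilb.riesz_representation[where L = "\<lambda>f. taylor_coeff f n" and C = "B / s ^ n"])
      show "cmod (taylor_coeff f n) \<le> B / s ^ n * sqrt (Re (ip f f))" if "f \<in> H" for f
        by (rule bound[OF that])
      fix p assume p: "p \<in> H" "\<And>f. f \<in> H \<Longrightarrow> taylor_coeff f n = ip f p"
      show thesis by (rule that[OF p])
    qed (simp_all add: taylor_coeff_add taylor_coeff_cmult analytic_0)
    then show ?thesis by (intro exI[of _ u] conjI ballI u)
  qed
  then obtain U where U: "\<And>n. U n \<in> H" and U_repr: "\<And>n f. f \<in> H \<Longrightarrow> taylor_coeff f n = ip f (U n)"
    by metis
  have U_eq: "monom_fun n = (\<lambda>z. of_real (q_fact q n / c) * U n z)" for n
  proof
    fix w
    show "monom_fun n w = of_real (q_fact q n / c) * U n w"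
    proof (cases "w \<in> \<Omega>")
      case True
      \<comment> \<open>The representer \<open>U n\<close> of the \<open>n\<close>-th coefficient is
        evaluated by pairing with \<open>K w\<close>; this is the conjugate of the
        \<open>n\<close>-th coefficient of \<open>K w\<close>.\<close>
      have "U n w = cnj (ip (K w) (U n))"
        using K_repr[OF True U] ip_cnj[OF K[OF True] U] by simp
      also have "\<dots> = of_real c * w ^ n / of_real (q_fact q n)"
        unfolding U_repr[OF K[OF True], symmetric] tc_K[OF True] by simp
      finally show ?thesis
        using True c q_fact_pos[OF q(1), of n] by (simp add: monom_fun_def)
    next
      case False
      then show ?thesis using outside[OF U] by (simp add: monom_fun_def)
    qed
  qed
  have mem: "monom_fun n \<in> H" for n unfolding U_eq by (rule scale_mem[OF U])
  \<comment> \<open>A kernel \<open>c\<close> times that of \<open>H2q\<close> corresponds to an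
    inner product scaled by \<open>1 / c\<close>.\<close>
  have "ip f (monom_fun n) = of_real (1 / c * q_fact q n) * taylor_coeff f n" if "f \<in> H" for f n
    unfolding U_eq hilb.ip_scale_right[OF U that] U_repr[OF that] by simp
  from equals_H2q_if_taylor_coeff_represented[OF q _ mem this] c show ?thesis by simp
qed

end

text \<open>Uniqueness is asserted under either of two readings: continuous point evaluations, or
  operators defined on the whole space. The zero space satisfies the adjoint relation trivially and
  is therefore excluded.\<close>

theorem theorem3p9:
  fixes q :: real
  assumes "0 \<le> q" and "q < 1"
  shows
    "(analytic_hilbert_space (H2q_disc q) (H2q q) (H2q_inner q) \<and>
      H2q q \<noteq> {\<lambda>z. 0} \<and>
      has_reproducing_kernel (H2q_disc q) (H2q q) (H2q_inner q) (\<lambda>z w. E_q q (z * cnj w)) \<and>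
      Domain (Rq_graph q (H2q q)) = H2q q \<and> Domain (Mz_graph (H2q q)) = H2q q \<and>
      adjoint_graph (H2q q) (H2q_inner q) (Rq_graph q (H2q q)) = Mz_graph (H2q q)) \<and>
     (\<forall>\<Omega> H ip.
        analytic_hilbert_space \<Omega> H ip \<longrightarrow>
        H \<noteq> {\<lambda>z. 0} \<longrightarrow>
        bounded_evaluations \<Omega> H ip \<or> (Domain (Rq_graph q H) = H \<and> Domain (Mz_graph H) = H) \<longrightarrow>
        adjoint_graph H ip (Rq_graph q H) = Mz_graph H \<longrightarrow>
        equals_H2q_up_to_factor q H ip)"
proof (intro conjI allI impI)
  show "analytic_hilbert_space (H2q_disc q) (H2q q) (H2q_inner q)"
    by (rule H2q_analytic_hilbert_space[OF assms])
  show "H2q q \<noteq> {\<lambda>z. 0}" by (rule H2q_nontrivial[OF assms])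
  show "has_reproducing_kernel (H2q_disc q) (H2q q) (H2q_inner q) (\<lambda>z w. E_q q (z * cnj w))"
    by (rule H2q_reproducing_kernel[OF assms])
  show "Domain (Rq_graph q (H2q q)) = H2q q" "Domain (Mz_graph (H2q q)) = H2q q"
    by (rule H2q_domains[OF assms])+
  show "adjoint_graph (H2q q) (H2q_inner q) (Rq_graph q (H2q q)) = Mz_graph (H2q q)"
    by (rule H2q_adjoint[OF assms])
next
  fix \<Omega> H ip
  assume H: "analytic_hilbert_space \<Omega> H ip" "H \<noteq> {\<lambda>z. 0}"
    and cases: "bounded_evaluations \<Omega> H ip \<or> (Domain (Rq_graph q H) = H \<and> Domain (Mz_graph H) = H)"
    and adjoint: "adjoint_graph H ip (Rq_graph q H) = Mz_graph H"
  from cases show "equals_H2q_up_to_factor q H ip"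
  proof (elim disjE conjE)
    assume "bounded_evaluations \<Omega> H ip"
    then show ?thesis
      by (rule analytic_hilbert_space.equals_H2q_if_bounded_evaluations[OF H(1) assms H(2) _ adjoint])
  next
    assume "Domain (Rq_graph q H) = H" "Domain (Mz_graph H) = H"
    then show ?thesis
      by (rule analytic_hilbert_space.equals_H2q_if_total[OF H(1) assms H(2) _ _ adjoint])
  qed
qed

end
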